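(* Let $\alpha>0$, let $\nu\in\mathcal{P}_+$, and let $\{N(t):t\ge0\}$ be the renewal process for the Kendall convolution $\vartriangle_\alpha$ with unit step distribution $\nu$. (i) If $H\in RV_\theta$, where $0\le\theta<\alpha$, then $\overline{G}(t)N(t)$ converges in distribution as $t\to\infty$ to a random variable $Z$ whose law is the convex combination $$\mathcal{L}(Z)=\frac{\theta}{\alpha}\,\Gamma(1,1)+\Bigl(1-\frac{\theta}{\alpha}\Bigr)\Gamma(2,1).$$ (ii) If $H\in RV_0$ (i.e. $\theta=0$), then $\overline{G}(t)N(t)$ converges in distribution as $t\to\infty$ to $Z$ with $\mathcal{L}(Z)=\Gamma(2,1)$.
   Context: $\mathcal{P}_+$ is the set of Borel probability measures on $[0,\infty)$. For $\alpha>0$ the Kendall convolution $\vartriangle_\alpha$ is the commutative, associative operation on $\mathcal{P}_+$ given by $\delta_x\vartriangle_\alpha\delta_1=(1-x^\alpha)\delta_1+x^\alpha\pi_{2\alpha}$ for $x\in[0,1]$, where $\pi_{2\alpha}(dy)=2\alpha y^{-2\alpha-1}\mathbf{1}_{[1,\infty)}(y)\,dy$; by scaling, for $0\le x\le y$, $y>0$, $\delta_x\vartriangle_\alpha\delta_y$ is the law of $yX$ where $X$ has law $\delta_{x/y}\vartriangle_\alpha\delta_1$; $\delta_0\vartriangle_\alpha\delta_0=\delta_0$; and $(\lambda_1\vartriangle_\alpha\lambda_2)(A)=\int\int(\delta_x\vartriangle_\alpha\delta_y)(A)\,\lambda_1(dx)\lambda_2(dy)$. $\nu^{\vartriangle_\alpha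 n}$ is the $n$-fold convolution power. The Kendall random walk with step distribution $\nu$ is the Markov process $(S_n)_{n\ge1}$ with $\mathcal{L}(S_1)=\nu$ and $P(S_n\in\cdot\mid S_k=x)=\delta_x\vartriangle_\alpha\nu^{\vartriangle_\alpha(n-k)}$ for $k<n$. The renewal process is $N(t)=\inf\{n\ge0:S_{n+1}>t\}$ ($=\infty$ if no such $n$ exists). For $t>0$: $G(t)=\int_{[0,\infty)}(1-x^\alpha/t^\alpha)_+\,\nu(dx)$ with $a_+=\max\{a,0\}$, $\overline G=1-G$, $H(t)=\int_{[0,t]}x^\alpha\,\nu(dx)$. A measurable function $f$, positive for all sufficiently large arguments, is in $RV_\beta$ if $\lim_{t\to\infty}f(tx)/f(t)=x^\beta$ for all $x>0$. $\Gamma(p,b)$ is the probability measure with density $\frac{b^p}{\Gamma(p)}x^{p-1}e^{-bx}\mathbf{1}_{[0,\infty)}(x)$. *)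

theory Defs
  imports "HOL-Probability.Probability"
begin

section \<open>Probability measures on the half-line\<close>

definition nonneg_borel_probs :: "real measure set" where
  "nonneg_borel_probs = {\<nu>. real_distribution \<nu> \<and> measure \<nu> {0..} = 1}"

text \<open>The convex combination \<open>p M + (1 - p) N\<close>, meant for \<open>p \<in> {0..1}\<close> and for measures
  \<open>M\<close>, \<open>N\<close> on the same measurable space.\<close>

definition convex_comb :: "real \<Rightarrow> 'a measure \<Rightarrow> 'a measure \<Rightarrow> 'a measure" where
  "convex_comb p M N = measure_of (space M) (sets M)
     (\<lambda>A. ennreal p * emeasure M A + ennreal (1 - p) * emeasure N A)"

definition pareto_measure :: "real \<Rightarrow> real measure" where
  "pareto_measure b = density lborel (\<lambda>y. ennreal (b * y powr (- b - 1) * indicator {1..} y))"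

definition gamma_measure :: "real \<Rightarrow> real \<Rightarrow> real measure" where
  "gamma_measure p b = density lborel
     (\<lambda>x. ennreal (b powr p / Gamma p * x powr (p - 1) * exp (- b * x) * indicator {0..} x))"

section \<open>The Kendall convolution\<close>

text \<open>\<open>kendall_unit \<alpha> x\<close> is \<open>\<delta>\<^sub>x \<triangle> \<delta>\<^sub>1\<close> for \<open>x \<in> {0..1}\<close>.\<close>

definition kendall_unit :: "real \<Rightarrow> real \<Rightarrow> real measure" where
  "kendall_unit \<alpha> x = convex_comb (x powr \<alpha>) (pareto_measure (2 * \<alpha>)) (return borel 1)"

text \<open>\<open>kendall_dirac \<alpha> x y\<close> is \<open>\<delta>\<^sub>x \<triangle> \<delta>\<^sub>y\<close> for \<open>x, y \<ge> 0\<close>. At \<open>x = y = 0\<close> it is \<open>\<delta>\<^sub>0\<close>; a negative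
  argument also gives the dummy value \<open>\<delta>\<^sub>0\<close>, which keeps the map a probability kernel on all of
  \<open>real \<times> real\<close>, as the Giry bind below needs. Measures in \<open>nonneg_borel_probs\<close> do not charge
  negative arguments.\<close>

definition kendall_dirac :: "real \<Rightarrow> real \<Rightarrow> real \<Rightarrow> real measure" where
  "kendall_dirac \<alpha> x y =
     (if 0 \<le> min x y \<and> 0 < max x y
      then distr (kendall_unit \<alpha> (min x y / max x y)) borel (\<lambda>z. max x y * z)
      else return borel 0)"

definition kendall_conv :: "real \<Rightarrow> real measure \<Rightarrow> real measure \<Rightarrow> real measure" where
  "kendall_conv \<alpha> L1 L2 = L1 \<bind> (\<lambda>x. L2 \<bind> (\<lambda>y. kendall_dirac \<alpha> x y))"

text \<open>The power with exponent 0 is the neutral element \<open>\<delta>\<^sub>0\<close>.\<close>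

primrec kendall_power :: "real \<Rightarrow> real measure \<Rightarrow> nat \<Rightarrow> real measure" where
  "kendall_power \<alpha> \<nu> 0 = return borel 0"
| "kendall_power \<alpha> \<nu> (Suc n) = kendall_conv \<alpha> \<nu> (kendall_power \<alpha> \<nu> n)"

subsection \<open>The definitions denote the intended measures\<close>

lemma sets_convex_comb [simp, measurable_cong]: "sets (convex_comb p M N) = sets M"
  by (simp add: convex_comb_def)

lemma space_convex_comb [simp]: "space (convex_comb p M N) = space M"
  by (simp add: convex_comb_def)

lemma emeasure_convex_comb:
  assumes "sets N = sets M" "A \<in> sets M"
  shows "emeasure (convex_comb p M N) A
           = ennreal p * emeasure M A + ennreal (1 - p) * emeasure N A"
proof (rule emeasure_measure_of[OF convex_comb_def])
  show "countably_additive (sets (convex_comb p M N))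
          (\<lambda>A. ennreal p * emeasure M A + ennreal (1 - p) * emeasure N A)"
  proof (rule countably_additiveI)
    fix B :: "nat \<Rightarrow> 'a set"
    assume "range B \<subseteq> sets (convex_comb p M N)" "disjoint_family B"
    then have "(\<Sum>i. emeasure M (B i)) = emeasure M (\<Union>i. B i)"
      "(\<Sum>i. emeasure N (B i)) = emeasure N (\<Union>i. B i)"
      using assms by (auto intro!: suminf_emeasure)
    then show "(\<Sum>i. ennreal p * emeasure M (B i) + ennreal (1 - p) * emeasure N (B i))
        = ennreal p * emeasure M (\<Union>i. B i) + ennreal (1 - p) * emeasure N (\<Union>i. B i)"
      by (simp add: suminf_add[symmetric])
  qed
qed (use assms in \<open>auto simp: positive_def sets.space_closed\<close>)

lemma prob_space_convex_comb:
  assumes "prob_space M" "prob_space N" "sets N = sets M" "0 \<le> p" "p \<le> 1"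
  shows "prob_space (convex_comb p M N)"
proof
  have "space N = space M"
    using assms(3) by (rule sets_eq_imp_space_eq)
  then show "emeasure (convex_comb p M N) (space (convex_comb p M N)) = 1"
    using assms prob_space.emeasure_space_1[OF assms(1)] prob_space.emeasure_space_1[OF assms(2)]
    by (simp add: emeasure_convex_comb ennreal_plus[symmetric] del: ennreal_plus)
qed

lemma sets_pareto_measure [simp, measurable_cong]: "sets (pareto_measure b) = sets borel"
  by (simp add: pareto_measure_def)

lemma space_pareto_measure [simp]: "space (pareto_measure b) = UNIV"
  by (simp add: pareto_measure_def)

lemma prob_space_pareto_measure:
  assumes "b > 0"
  shows "prob_space (pareto_measure b)"
proof
  have "(\<integral>\<^sup>+y. ennreal (b * y powr (- b - 1)) * indicator {1..} y \<partial>lborel)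
      = ennreal (0 - (- (1 powr (- b))))"
  proof (rule nn_integral_FTC_atLeast)
    show "((\<lambda>y. - (y powr (- b))) \<longlongrightarrow> 0) at_top"
      using assms by real_asymp
    show "((\<lambda>y. - (y powr (- b))) has_real_derivative b * y powr (- b - 1)) (at y)"
      if "1 \<le> y" for y
      using that by (auto intro!: derivative_eq_intros)
  qed (use assms in auto)
  then show "emeasure (pareto_measure b) (space (pareto_measure b)) = 1"
    by (simp add: pareto_measure_def emeasure_density indicator_mult_ennreal mult.commute)
qed

lemma sets_kendall_unit [simp, measurable_cong]: "sets (kendall_unit \<alpha> x) = sets borel"
  by (simp add: kendall_unit_def)

lemma prob_space_kendall_unit:
  assumes "\<alpha> > 0" "0 \<le> x" "x \<le> 1"
  shows "prob_space (kendall_unit \<alpha> x)"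
  unfolding kendall_unit_def using assms
  by (intro prob_space_convex_comb prob_space_pareto_measure prob_space_return)
     (auto intro: powr_le1)

lemma sets_kendall_dirac [simp, measurable_cong]: "sets (kendall_dirac \<alpha> x y) = sets borel"
  by (simp add: kendall_dirac_def)

lemma prob_space_kendall_dirac:
  assumes "\<alpha> > 0"
  shows "prob_space (kendall_dirac \<alpha> x y)"
  unfolding kendall_dirac_def using assms
  by (auto intro!: prob_space.prob_space_distr prob_space_kendall_unit prob_space_return
      simp: divide_le_eq split: if_splits)

lemma emeasure_kendall_dirac:
  assumes "0 \<le> min x y" "0 < max x y" "A \<in> sets borel"
  shows "emeasure (kendall_dirac \<alpha> x y) A
    = ennreal ((min x y / max x y) powr \<alpha>)
        * (\<integral>\<^sup>+z. indicator A (max x y * z) \<partial>pareto_measure (2 * \<alpha>))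
      + ennreal (1 - (min x y / max x y) powr \<alpha>) * indicator A (max x y)"
proof -
  have [measurable]: "A \<in> sets borel" by fact
  have mult_vimage: "(\<lambda>z. max x y * z) -` A \<in> sets borel"
    using measurable_sets[of "\<lambda>z. max x y * z" borel borel A] by simp
  have "(\<integral>\<^sup>+z. indicator A (max x y * z) \<partial>pareto_measure (2 * \<alpha>))
      = emeasure (pareto_measure (2 * \<alpha>)) ((\<lambda>z. max x y * z) -` A)"
    using mult_vimage by (simp add: nn_integral_indicator[symmetric] indicator_vimage)
  moreover have "emeasure (kendall_dirac \<alpha> x y) A
      = emeasure (kendall_unit \<alpha> (min x y / max x y)) ((\<lambda>z. max x y * z) -` A)"
    unfolding kendall_dirac_def using assms(1,2)
    by (simp add: emeasure_distr kendall_unit_def)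
  ultimately show ?thesis
    unfolding kendall_unit_def using mult_vimage
    by (simp add: emeasure_convex_comb indicator_def)
qed

lemma measurable_kendall_dirac:
  assumes "\<alpha> > 0"
  shows "(\<lambda>(x, y). kendall_dirac \<alpha> x y) \<in> borel \<Otimes>\<^sub>M borel \<rightarrow>\<^sub>M prob_algebra borel"
proof (rule measurable_prob_algebraI)
  show "prob_space (case a of (x, y) \<Rightarrow> kendall_dirac \<alpha> x y)" for a
    using prob_space_kendall_dirac[OF assms] by (simp split: prod.split)
  show "(\<lambda>(x, y). kendall_dirac \<alpha> x y) \<in> borel \<Otimes>\<^sub>M borel \<rightarrow>\<^sub>M subprob_algebra borel"
  proof (rule measurable_subprob_algebra)
    fix A :: "real set"
    assume A [measurable]: "A \<in> sets borel"
    interpret pareto: prob_space "pareto_measure (2 * \<alpha>)"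
      using assms by (intro prob_space_pareto_measure) simp
    have eq: "emeasure (case a of (x, y) \<Rightarrow> kendall_dirac \<alpha> x y) A
      = (if 0 \<le> min (fst a) (snd a) \<and> 0 < max (fst a) (snd a)
         then ennreal ((min (fst a) (snd a) / max (fst a) (snd a)) powr \<alpha>)
             * (\<integral>\<^sup>+z. indicator A (max (fst a) (snd a) * z) \<partial>pareto_measure (2 * \<alpha>))
           + ennreal (1 - (min (fst a) (snd a) / max (fst a) (snd a)) powr \<alpha>)
             * indicator A (max (fst a) (snd a))
         else indicator A 0)" for a
    proof (cases "0 \<le> min (fst a) (snd a) \<and> 0 < max (fst a) (snd a)")
      case True
      then show ?thesis
        using emeasure_kendall_dirac[OF _ _ A] by (simp add: case_prod_beta)
    next
      case False
      then have "kendall_dirac \<alpha> (fst a) (snd a) = return borel 0"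
        unfolding kendall_dirac_def by (rule if_not_P)
      then show ?thesis
        using False by (simp only: case_prod_beta if_False emeasure_return[OF A])
    qed
    show "(\<lambda>a. emeasure (case a of (x, y) \<Rightarrow> kendall_dirac \<alpha> x y) A)
        \<in> borel_measurable (borel \<Otimes>\<^sub>M borel)"
      unfolding eq by measurable
  qed (auto intro: prob_space_imp_subprob_space prob_space_kendall_dirac[OF assms])
qed

lemma emeasure_kendall_conv:
  assumes "\<alpha> > 0" "real_distribution L1" "real_distribution L2" "A \<in> sets borel"
  shows "emeasure (kendall_conv \<alpha> L1 L2) A
           = (\<integral>\<^sup>+x. \<integral>\<^sup>+y. emeasure (kendall_dirac \<alpha> x y) A \<partial>L2 \<partial>L1)"
proof -
  interpret L1: real_distribution L1 by fact
  interpret L2: real_distribution L2 by fact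
  have kernel: "(\<lambda>(x, y). kendall_dirac \<alpha> x y) \<in> L1 \<Otimes>\<^sub>M L2 \<rightarrow>\<^sub>M subprob_algebra borel"
    using measurable_prob_algebraD[OF measurable_kendall_dirac[OF assms(1)]]
    by (simp cong: measurable_cong_sets sets_pair_measure_cong)
  have L2_const: "(\<lambda>x. L2) \<in> L1 \<rightarrow>\<^sub>M subprob_algebra L2"
    by (intro measurable_const) (simp add: space_subprob_algebra L2.subprob_space_axioms)
  have "emeasure (kendall_conv \<alpha> L1 L2) A
      = (\<integral>\<^sup>+x. emeasure (L2 \<bind> kendall_dirac \<alpha> x) A \<partial>L1)"
    unfolding kendall_conv_def
    using measurable_bind'[OF L2_const kernel] assms(4) by (intro emeasure_bind) auto
  also have "\<dots> = (\<integral>\<^sup>+x. \<integral>\<^sup>+y. emeasure (kendall_dirac \<alpha> x y) A \<partial>L2 \<partial>L1)"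
  proof (rule nn_integral_cong)
    fix x
    assume "x \<in> space L1"
    then have "kendall_dirac \<alpha> x \<in> L2 \<rightarrow>\<^sub>M subprob_algebra borel"
      using measurable_compose[OF measurable_Pair1' kernel] by simp
    then show "emeasure (L2 \<bind> kendall_dirac \<alpha> x) A
        = (\<integral>\<^sup>+y. emeasure (kendall_dirac \<alpha> x y) A \<partial>L2)"
      using assms(4) by (intro emeasure_bind) auto
  qed
  finally show ?thesis .
qed

section \<open>The Kendall random walk and its renewal process\<close>

text \<open>The \<open>\<sigma>\<close>-algebra generated by \<open>S 1, \<dots>, S k\<close>.\<close>

definition walk_history :: "'a measure \<Rightarrow> (nat \<Rightarrow> 'a \<Rightarrow> real) \<Rightarrow> nat \<Rightarrow> 'a measure" where
  "walk_history M S k =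
     sigma (space M) {S i -` A \<inter> space M | i A. 1 \<le> i \<and> i \<le> k \<and> A \<in> sets borel}"

text \<open>Time starts at 1; \<open>S 0\<close> is unconstrained and never used. The last condition is the Markov
  property together with the transition law \<open>\<delta>\<^sub>x \<triangle> \<nu>\<^bsup>\<triangle>(n - k)\<^esup>\<close> from time \<open>k\<close> to time \<open>n\<close>.\<close>

definition kendall_random_walk ::
  "'a measure \<Rightarrow> real \<Rightarrow> real measure \<Rightarrow> (nat \<Rightarrow> 'a \<Rightarrow> real) \<Rightarrow> bool" where
  "kendall_random_walk M \<alpha> \<nu> S \<longleftrightarrow>
     prob_space M \<and>
     (\<forall>n\<ge>1. S n \<in> borel_measurable M) \<and>
     distr M borel (S 1) = \<nu> \<and>
     (\<forall>k n A. 1 \<le> k \<and> k < n \<and> A \<in> sets borel \<longrightarrow>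
        (AE \<omega> in M. real_cond_exp M (walk_history M S k) (indicator (S n -` A \<inter> space M)) \<omega>
           = measure (kendall_conv \<alpha> (return borel (S k \<omega>)) (kendall_power \<alpha> \<nu> (n - k))) A))"

text \<open>The infimum of the empty set in \<^typ>\<open>enat\<close> is \<open>\<infinity>\<close>.\<close>

definition renewal_process :: "(nat \<Rightarrow> 'a \<Rightarrow> real) \<Rightarrow> real \<Rightarrow> 'a \<Rightarrow> enat" where
  "renewal_process S t \<omega> = (INF n \<in> {n. S (Suc n) \<omega> > t}. enat n)"

definition kendall_G :: "real \<Rightarrow> real measure \<Rightarrow> real \<Rightarrow> real" where
  "kendall_G \<alpha> \<nu> t = (LINT x:{0..}|\<nu>. max (1 - x powr \<alpha> / t powr \<alpha>) 0)"

definition kendall_G_bar :: "real \<Rightarrow> real measure \<Rightarrow> real \<Rightarrow> real" where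
  "kendall_G_bar \<alpha> \<nu> t = 1 - kendall_G \<alpha> \<nu> t"

definition kendall_H :: "real \<Rightarrow> real measure \<Rightarrow> real \<Rightarrow> real" where
  "kendall_H \<alpha> \<nu> t = (LINT x:{0..t}|\<nu>. x powr \<alpha>)"

section \<open>Regular variation and convergence in distribution\<close>

definition regularly_varying :: "real \<Rightarrow> (real \<Rightarrow> real) \<Rightarrow> bool" where
  "regularly_varying \<beta> f \<longleftrightarrow>
     f \<in> borel_measurable borel \<and>
     (\<forall>\<^sub>F t in at_top. f t > 0) \<and>
     (\<forall>x>0. ((\<lambda>t. f (t * x) / f t) \<longlongrightarrow> x powr \<beta>) at_top)"

text \<open>As \<^const>\<open>weak_conv_m\<close>, but along an arbitrary filter and for variables that may take
  infinite values; the limit law \<open>L\<close> lives on the reals, so no mass may escape to \<open>\<plusminus>\<infinity>\<close>.\<close>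

definition converges_in_distribution ::
  "'a measure \<Rightarrow> ('b \<Rightarrow> 'a \<Rightarrow> ereal) \<Rightarrow> real measure \<Rightarrow> 'b filter \<Rightarrow> bool" where
  "converges_in_distribution M X L F \<longleftrightarrow>
     real_distribution L \<and>
     (\<forall>x. isCont (cdf L) x \<longrightarrow>
        ((\<lambda>t. measure M {\<omega> \<in> space M. X t \<omega> \<le> ereal x}) \<longlongrightarrow> cdf L x) F)"

end

theory Submission
  imports Defs "HOL-Real_Asymp.Real_Asymp"
begin

text \<open>The map \<open>L \<mapsto> \<integral> (1 - x\<^sup>\<alpha> / t\<^sup>\<alpha>)\<^sub>+ dL\<close> is multiplicative for the Kendall convolution. Together
  with the formula for the distribution function of \<open>\<delta>\<^sub>x \<triangle> \<delta>\<^sub>y\<close> this gives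
  \<open>P(S\<^sub>n \<le> t) = G(t)\<^sup>n + n h(t) G(t)\<^bsup>n-1\<^esup>\<close> with \<open>h(t) = t\<^bsup>-\<alpha>\<^esup> H(t)\<close>. The walk almost surely never
  returns below a level it has exceeded, so \<open>P(N(t) \<le> k) = 1 - P(S\<^bsub>k+1\<^esub> \<le> t)\<close>. With \<open>\<epsilon> = 1 - G(t)\<close>
  and \<open>k = \<lfloor>x / \<epsilon>\<rfloor>\<close> one has \<open>G(t)\<^sup>k \<rightarrow> exp(-x)\<close> and \<open>k \<epsilon> \<rightarrow> x\<close>, and it remains to see that
  \<open>h / \<epsilon> \<rightarrow> 1 - \<theta> / \<alpha>\<close>. This is Karamata's theorem for \<open>\<epsilon> = \<integral>\<^sub>1\<^sup>\<infinity> \<alpha> s\<^bsup>-\<alpha>-1\<^esup> t\<^bsup>-\<alpha>\<^esup> H(ts) ds\<close>, proved by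
  dominated convergence; the dominating function comes from the monotonicity of \<open>H\<close>.\<close>

section \<open>Integrals against the Kendall convolution\<close>

text \<open>The mixture is given only by its values on sets, so the formula is lifted from
  indicators to nonnegative measurable functions by induction.\<close>

lemma nn_integral_convex_comb:
  assumes [simp]: "sets N = sets M" and "f \<in> borel_measurable M"
  shows "(\<integral>\<^sup>+x. f x \<partial>convex_comb p M N)
    = ennreal p * (\<integral>\<^sup>+x. f x \<partial>M) + ennreal (1 - p) * (\<integral>\<^sup>+x. f x \<partial>N)"
proof -
  have spc: "space N = space M"
    using assms(1) by (rule sets_eq_imp_space_eq)
  have eqs: "borel_measurable N = (borel_measurable M :: ('a \<Rightarrow> ennreal) set)"
    "borel_measurable (convex_comb p M N) = (borel_measurable M :: ('a \<Rightarrow> ennreal) set)"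
    by (auto intro!: measurable_cong_sets)
  show ?thesis
    using assms(2)
  proof (induction rule: borel_measurable_induct)
    case (cong f g)
    then have "integral\<^sup>N L f = integral\<^sup>N L g" if "space L = space M" for L
      using that by (intro nn_integral_cong) auto
    then show ?case
      using cong(4) spc by simp
  next
    case (set A)
    then show ?case by (simp add: emeasure_convex_comb)
  next
    case (mult u c)
    then show ?case
      by (simp add: nn_integral_cmult eqs distrib_left mult.left_commute)
  next
    case (add u v)
    then show ?case
      by (simp add: nn_integral_add eqs distrib_left ac_simps)
  next
    case (seq U)
    have sup: "integral\<^sup>N L (SUP i. U i) = (SUP i. integral\<^sup>N L (U i))"
      if "borel_measurable L = (borel_measurable M :: ('a \<Rightarrow> ennreal) set)" for L
    proof -
      have "(SUP i. U i) = (\<lambda>x. SUP i. U i x)"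
        by (auto simp: fun_eq_iff image_comp)
      then show ?thesis
        using nn_integral_monotone_convergence_SUP[of U L] seq(1,3) that by simp
    qed
    \<comment> \<open>The supremum of a sum splits into the sum of the suprema because both
      sequences are increasing.\<close>
    have inc: "incseq (\<lambda>i. ennreal c * integral\<^sup>N L (U i))" for c L
      using \<open>incseq U\<close>
      by (auto simp: incseq_def le_fun_def intro!: mult_left_mono nn_integral_mono)
    show ?case
      unfolding sup[OF refl] sup[OF eqs(1)] sup[OF eqs(2)] seq.IH
      by (simp add: SUP_mult_left_ennreal ennreal_SUP_add[OF inc inc])
  qed
qed

lemma nn_integral_kendall_dirac:
  assumes "0 \<le> min x y" "0 < max x y" and [measurable]: "f \<in> borel_measurable borel"
  shows "(\<integral>\<^sup>+z. f z \<partial>kendall_dirac \<alpha> x y)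
    = ennreal ((min x y / max x y) powr \<alpha>) * (\<integral>\<^sup>+z. f (max x y * z) \<partial>pareto_measure (2 * \<alpha>))
      + ennreal (1 - (min x y / max x y) powr \<alpha>) * f (max x y)"
proof -
  have "(\<integral>\<^sup>+z. f z \<partial>kendall_dirac \<alpha> x y)
      = (\<integral>\<^sup>+z. f (max x y * z) \<partial>kendall_unit \<alpha> (min x y / max x y))"
    unfolding kendall_dirac_def using assms(1,2) by (simp add: nn_integral_distr)
  then show ?thesis
    unfolding kendall_unit_def by (simp add: nn_integral_convex_comb nn_integral_return)
qed

text \<open>Scaling by a positive factor keeps both the Pareto law and the atom above 0, and the
  default value, the point mass at 0, has no negative mass either. The property then passes to
  convolutions by integration.\<close>

lemma emeasure_kendall_dirac_neg: "emeasure (kendall_dirac \<alpha> x y) {..<0} = 0"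
proof (cases "0 \<le> min x y \<and> 0 < max x y")
  case True
  have "(\<integral>\<^sup>+z. indicator {..<0} (max x y * z) \<partial>pareto_measure (2 * \<alpha>)) = 0"
    unfolding pareto_measure_def using True
    by (subst nn_integral_density)
       (auto simp: nn_integral_0_iff_AE mult_less_0_iff split: split_indicator)
  then show ?thesis
    using True by (subst emeasure_kendall_dirac) (auto split: split_indicator)
qed (auto simp: kendall_dirac_def)

text \<open>For \<open>d = 0\<close> this tests for the distribution function and for \<open>d = 1\<close> for \<^const>\<open>kendall_G\<close>.\<close>

definition kendall_test :: "real \<Rightarrow> real \<Rightarrow> real \<Rightarrow> real \<Rightarrow> real" where
  "kendall_test \<alpha> t d z = (1 - d * (z / t) powr \<alpha>) * indicator {0..t} z"

lemma kendall_test_measurable [measurable]: "kendall_test \<alpha> t d \<in> borel_measurable borel"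
  unfolding kendall_test_def by measurable

lemma powr_ratio_le_1:
  fixes z t \<alpha> :: real
  assumes "0 \<le> z" "z \<le> t" "0 < t" "0 \<le> \<alpha>"
  shows "(z / t) powr \<alpha> \<le> 1"
  using assms by (intro powr_le1) auto

section \<open>Test integrals for two point masses\<close>

text \<open>After scaling, the test function lives on z at most t / m, where its product with the
  Pareto density has the elementary antiderivative \<open>?F\<close>. The value is
  \<open>1 - w^2\<close> for d = 0 and \<open>(1 - w)^2\<close> for d = 1.\<close>

lemma nn_integral_pareto_kendall_test:
  assumes "\<alpha> > 0" "0 < m" "m \<le> t" "0 \<le> d" "d \<le> 1"
  defines "w \<equiv> (m / t) powr \<alpha>"
  shows "(\<integral>\<^sup>+z. ennreal (kendall_test \<alpha> t d (m * z)) \<partial>pareto_measure (2 * \<alpha>))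
    = ennreal (1 - 2 * d * w + (2 * d - 1) * w\<^sup>2)"
proof -
  let ?f = "\<lambda>z. 2 * \<alpha> * z powr (- 2 * \<alpha> - 1) - 2 * \<alpha> * d * w * z powr (- \<alpha> - 1)"
  let ?F = "\<lambda>z. - (z powr (- 2 * \<alpha>)) + 2 * d * w * z powr (- \<alpha>)"
  have pos: "t > 0" using assms by simp
  have f_eq: "?f z = (2 * \<alpha> * z powr (- 2 * \<alpha> - 1)) * (1 - d * (m * z / t) powr \<alpha>)"
    if "1 \<le> z" for z
  proof -
    have "(m * z / t) powr \<alpha> = w * z powr \<alpha>"
      using that assms pos by (simp add: w_def powr_mult[symmetric])
    moreover have "z powr (- \<alpha> - 1) = z powr \<alpha> * z powr (- 2 * \<alpha> - 1)"
      using that by (simp add: powr_add[symmetric])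
    ultimately show ?thesis by (simp add: algebra_simps)
  qed
  have "(\<integral>\<^sup>+z. ennreal (kendall_test \<alpha> t d (m * z)) \<partial>pareto_measure (2 * \<alpha>))
      = (\<integral>\<^sup>+z. ennreal (?f z) * indicator {1..t / m} z \<partial>lborel)"
    unfolding pareto_measure_def
  proof (subst nn_integral_density)
    show "(\<integral>\<^sup>+z. ennreal (2 * \<alpha> * z powr (- (2 * \<alpha>) - 1) * indicator {1..} z)
          * ennreal (kendall_test \<alpha> t d (m * z)) \<partial>lborel)
      = (\<integral>\<^sup>+z. ennreal (?f z) * indicator {1..t / m} z \<partial>lborel)"
    proof (rule nn_integral_cong)
      fix z :: real
      show "ennreal (2 * \<alpha> * z powr (- (2 * \<alpha>) - 1) * indicator {1..} z)
          * ennreal (kendall_test \<alpha> t d (m * z)) = ennreal (?f z) * indicator {1..t / m} z"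
      proof (cases "1 \<le> z")
        case True
        then show ?thesis
          using assms(1,2) f_eq[OF True]
          by (auto simp: kendall_test_def ennreal_mult'[symmetric] field_simps split: split_indicator)
      qed simp
    qed
  qed auto
  also have "\<dots> = ennreal (?F (t / m) - ?F 1)"
  proof (rule nn_integral_FTC_Icc)
    show "(?F has_real_derivative ?f z) (at z)" if "z \<in> {1..t / m}" for z
      using that by (auto intro!: derivative_eq_intros simp: algebra_simps)
    \<comment> \<open>The sign is read off the factored form \<open>f_eq\<close>: on this range m z
      does not exceed t, so the test factor is nonnegative.\<close>
    show "0 \<le> ?f z" if "z \<in> {1..t / m}" for z
    proof -
      have z: "1 \<le> z" "z \<le> t / m" using that by auto
      have "(m * z / t) powr \<alpha> \<le> 1"
        using z assms pos by (intro powr_ratio_le_1) (auto simp: field_simps)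
      then have "d * (m * z / t) powr \<alpha> \<le> 1"
        using assms by (intro mult_le_one) auto
      then show ?thesis
        unfolding f_eq[OF z(1)] using assms by simp
    qed
  qed (use assms pos in \<open>auto simp: field_simps\<close>)
  also have "?F (t / m) - ?F 1 = 1 - 2 * d * w + (2 * d - 1) * w\<^sup>2"
  proof -
    \<comment> \<open>The cutoff t / m is the reciprocal of the base of w, so both terms at the
      upper end are powers of w.\<close>
    have "(t / m) powr (- \<alpha>) = w"
      using assms pos by (simp add: w_def powr_minus powr_divide)
    moreover from this have "(t / m) powr (- 2 * \<alpha>) = w\<^sup>2"
      using powr_add[of "t / m" "- \<alpha>" "- \<alpha>"] by (simp add: power2_eq_square)
    ultimately show ?thesis
      by (simp add: power2_eq_square algebra_simps)
  qed
  finally show ?thesis .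
qed

text \<open>With l and m the smaller and the larger point, the Pareto part has weight q = (l /
  m)^\<alpha> and the atom at m has weight 1 - q. The result is symmetric in u and v and of degree
  one in each: \<open>1 - u * v\<close> for d = 0 and \<open>(1 - u) * (1 - v)\<close> for d = 1.
  This is what lets the integral over x and y factorise.\<close>

lemma nn_integral_kendall_dirac_test:
  assumes "\<alpha> > 0" "0 \<le> x" "0 \<le> y" "0 < t" "0 \<le> d" "d \<le> 1"
  defines "u \<equiv> (x / t) powr \<alpha>" and "v \<equiv> (y / t) powr \<alpha>"
  shows "(\<integral>\<^sup>+z. ennreal (kendall_test \<alpha> t d z) \<partial>kendall_dirac \<alpha> x y)
    = ennreal ((1 - d * u - d * v + (2 * d - 1) * (u * v)) * indicator {0..t} x * indicator {0..t} y)"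
proof (cases "max x y = 0")
  \<comment> \<open>With both points at 0 there is no ratio to form; \<open>kendall_dirac\<close> is
    then the point mass at 0.\<close>
  case True
  then have "x = 0" "y = 0" using assms by auto
  then show ?thesis
    using assms by (simp add: kendall_dirac_def nn_integral_return kendall_test_def)
next
  case False
  define m where "m = max x y"
  define l where "l = min x y"
  define w where "w = (m / t) powr \<alpha>"
  define q where "q = (l / m) powr \<alpha>"
  have m: "0 < m" "0 \<le> l" "l \<le> m" using False assms by (auto simp: m_def l_def)
  have q: "0 \<le> q" "q \<le> 1" using m assms by (auto simp: q_def intro: powr_ratio_le_1)
  have qw: "q * w = (l / t) powr \<alpha>"
    using m assms by (simp add: q_def w_def powr_mult[symmetric])
  \<comment> \<open>The unordered pairs {u, v} and {q w, w} agree, so passing to sum and product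
    removes the question which of x and y is larger.\<close>
  have sym: "u + v = q * w + w" "u * v = q * w * w"
    unfolding qw unfolding u_def v_def w_def m_def l_def by (auto simp: max_def min_def)
  have "(\<integral>\<^sup>+z. ennreal (kendall_test \<alpha> t d z) \<partial>kendall_dirac \<alpha> x y)
      = ennreal q * (\<integral>\<^sup>+z. ennreal (kendall_test \<alpha> t d (m * z)) \<partial>pareto_measure (2 * \<alpha>))
        + ennreal (1 - q) * ennreal (kendall_test \<alpha> t d m)"
    unfolding q_def m_def l_def using m by (intro nn_integral_kendall_dirac) (auto simp: m_def l_def)
  also have "\<dots> = ennreal ((1 - d * u - d * v + (2 * d - 1) * (u * v))
      * indicator {0..t} x * indicator {0..t} y)"
  proof (cases "m \<le> t")
    case True
    have w: "0 \<le> w" "w \<le> 1" using True m assms by (auto simp: w_def intro: powr_ratio_le_1)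
    have dw: "d * w \<le> 1" using w assms by (intro mult_le_one) auto
    \<comment> \<open>Regrouping as a convex combination of the values for d = 0 and d = 1 makes
      nonnegativity visible, which the arithmetic in \<open>ennreal\<close> needs.\<close>
    have "1 - 2 * d * w + (2 * d - 1) * w\<^sup>2 = (1 - d) * (1 - w\<^sup>2) + d * (1 - w)\<^sup>2"
      by (simp add: power2_eq_square algebra_simps)
    moreover have "\<dots> \<ge> 0"
      using w assms by (intro add_nonneg_nonneg mult_nonneg_nonneg) (auto simp: power_le_one)
    ultimately have nonneg: "0 \<le> 1 - 2 * d * w + (2 * d - 1) * w\<^sup>2" by simp
    have "ennreal q * (\<integral>\<^sup>+z. ennreal (kendall_test \<alpha> t d (m * z)) \<partial>pareto_measure (2 * \<alpha>))
        + ennreal (1 - q) * ennreal (kendall_test \<alpha> t d m)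
      = ennreal (q * (1 - 2 * d * w + (2 * d - 1) * w\<^sup>2) + (1 - q) * (1 - d * w))"
      using nn_integral_pareto_kendall_test[OF assms(1) m(1) True assms(5,6)] q m True nonneg dw
      by (simp add: kendall_test_def w_def[symmetric] ennreal_mult ennreal_plus)
    also have "q * (1 - 2 * d * w + (2 * d - 1) * w\<^sup>2) + (1 - q) * (1 - d * w)
      = 1 - d * (u + v) + (2 * d - 1) * (u * v)"
      unfolding sym by (simp add: power2_eq_square algebra_simps)
    also have "\<dots> = (1 - d * u - d * v + (2 * d - 1) * (u * v)) * indicator {0..t} x * indicator {0..t} y"
      using True assms by (simp add: m_def algebra_simps)
    finally show ?thesis .
  next
    case False
    have "(\<integral>\<^sup>+z. ennreal (kendall_test \<alpha> t d (m * z)) \<partial>pareto_measure (2 * \<alpha>)) = 0"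
    proof -
      \<comment> \<open>The Pareto law lives on \<open>{1..}\<close>, so scaling by m > t pushes it
        above t; the atom at m lies there too.\<close>
      have "m * z > t" if "z \<ge> 1" for z
        using mult_left_mono[OF that, of m] m False by linarith
      then show ?thesis
        unfolding pareto_measure_def
        by (subst nn_integral_density)
           (auto simp: nn_integral_0_iff_AE kendall_test_def not_le[symmetric] split: split_indicator)
    qed
    moreover have "indicator {0..t} x * indicator {0..t} y = (0 :: real)"
      using False by (auto simp: m_def split: split_indicator)
    ultimately show ?thesis
      using False by (auto simp: kendall_test_def mult.assoc)
  qed
  finally show ?thesis .
qed

section \<open>Closure of the laws on the half-line under convolution\<close>

lemma nonneg_borel_probs_iff:
  "\<nu> \<in> nonneg_borel_probs \<longleftrightarrow> real_distribution \<nu> \<and> (AE x in \<nu>. 0 \<le> x)"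
proof -
  have "measure \<nu> {0..} = 1 \<longleftrightarrow> (AE x in \<nu>. 0 \<le> x)" if "real_distribution \<nu>"
  proof -
    interpret real_distribution \<nu> by fact
    show ?thesis using prob_eq_1[of "{0..}"] by simp
  qed
  then show ?thesis by (auto simp: nonneg_borel_probs_def)
qed

lemma measurable_kendall_dirac_subprob [measurable]:
  assumes "\<alpha> > 0"
  shows "(\<lambda>(x, y). kendall_dirac \<alpha> x y) \<in> borel \<Otimes>\<^sub>M borel \<rightarrow>\<^sub>M subprob_algebra borel"
  by (rule measurable_prob_algebraD[OF measurable_kendall_dirac[OF assms]])

text \<open>A bind of probability kernels is a probability measure, and it has no negative mass
  because \<open>kendall_dirac\<close> has none.\<close>

lemma kendall_conv_nonneg_borel_probs:
  assumes "\<alpha> > 0" "real_distribution L1" "real_distribution L2"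
  shows "kendall_conv \<alpha> L1 L2 \<in> nonneg_borel_probs"
proof -
  interpret L1: real_distribution L1 by fact
  interpret L2: real_distribution L2 by fact
  have L2_in: "(\<lambda>x. L2) \<in> L1 \<rightarrow>\<^sub>M prob_algebra borel"
    using L2.prob_space_axioms by (simp add: space_prob_algebra)
  have k: "(\<lambda>(x, y). kendall_dirac \<alpha> x y) \<in> L1 \<Otimes>\<^sub>M borel \<rightarrow>\<^sub>M prob_algebra borel"
    using measurable_kendall_dirac[OF assms(1)]
    by (simp cong: measurable_cong_sets sets_pair_measure_cong)
  have inner: "(\<lambda>x. L2 \<bind> kendall_dirac \<alpha> x) \<in> L1 \<rightarrow>\<^sub>M prob_algebra borel"
    using measurable_bind_prob_space2[OF L2_in k] by simp
  have sets: "sets (kendall_conv \<alpha> L1 L2) = sets borel"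
    unfolding kendall_conv_def using measurable_prob_algebraD[OF inner]
    by (intro sets_bind) (auto intro: sets_kernel)
  have prob: "prob_space (kendall_conv \<alpha> L1 L2)"
    unfolding kendall_conv_def
    using inner by (intro L1.prob_space_bind[where S = borel])
      (auto intro!: AE_I2 dest: measurable_space simp: space_prob_algebra measurable_prob_algebraD)
  have "emeasure (kendall_conv \<alpha> L1 L2) {..<0} = 0"
    using assms L1.real_distribution_axioms L2.real_distribution_axioms
    by (subst emeasure_kendall_conv) (auto simp: emeasure_kendall_dirac_neg)
  moreover have "{x \<in> space (kendall_conv \<alpha> L1 L2). \<not> 0 \<le> x} = {..<0}"
    using sets_eq_imp_space_eq[OF sets] by auto
  ultimately have "AE x in kendall_conv \<alpha> L1 L2. 0 \<le> x"
    using sets by (intro AE_I[of _ _ "{..<0}"]) auto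
  then show ?thesis
    using prob sets by (auto simp: nonneg_borel_probs_iff real_distribution_def real_distribution_axioms_def)
qed

lemma nonneg_borel_probs_real_distribution: "L \<in> nonneg_borel_probs \<Longrightarrow> real_distribution L"
  by (simp add: nonneg_borel_probs_def)

lemma real_distribution_return: "real_distribution (return borel x)"
  by (auto simp: real_distribution_def real_distribution_axioms_def prob_space_return)

lemma return_nonneg_borel_probs: "0 \<le> x \<Longrightarrow> return borel x \<in> nonneg_borel_probs"
  by (auto simp: nonneg_borel_probs_iff real_distribution_return AE_return)

lemma kendall_power_nonneg_borel_probs:
  assumes "\<alpha> > 0" "\<nu> \<in> nonneg_borel_probs"
  shows "kendall_power \<alpha> \<nu> n \<in> nonneg_borel_probs"
  by (induction n) (auto intro: return_nonneg_borel_probs kendall_conv_nonneg_borel_probs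
      nonneg_borel_probs_real_distribution assms)

lemma nn_integral_kendall_conv:
  assumes "\<alpha> > 0" "real_distribution L1" "real_distribution L2"
    and [measurable]: "f \<in> borel_measurable borel"
  shows "(\<integral>\<^sup>+z. f z \<partial>kendall_conv \<alpha> L1 L2)
    = (\<integral>\<^sup>+x. \<integral>\<^sup>+y. \<integral>\<^sup>+z. f z \<partial>kendall_dirac \<alpha> x y \<partial>L2 \<partial>L1)"
proof -
  interpret L1: real_distribution L1 by fact
  interpret L2: real_distribution L2 by fact
  have kernel: "(\<lambda>(x, y). kendall_dirac \<alpha> x y) \<in> L1 \<Otimes>\<^sub>M L2 \<rightarrow>\<^sub>M subprob_algebra borel"
    using measurable_kendall_dirac_subprob[OF assms(1)]
    by (simp cong: measurable_cong_sets sets_pair_measure_cong)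
  have L2_const: "(\<lambda>x. L2) \<in> L1 \<rightarrow>\<^sub>M subprob_algebra L2"
    by (intro measurable_const) (simp add: space_subprob_algebra L2.subprob_space_axioms)
  have "(\<integral>\<^sup>+z. f z \<partial>kendall_conv \<alpha> L1 L2)
      = (\<integral>\<^sup>+x. \<integral>\<^sup>+z. f z \<partial>(L2 \<bind> kendall_dirac \<alpha> x) \<partial>L1)"
    unfolding kendall_conv_def
    using measurable_bind'[OF L2_const kernel] by (intro nn_integral_bind[where B = borel]) auto
  also have "\<dots> = (\<integral>\<^sup>+x. \<integral>\<^sup>+y. \<integral>\<^sup>+z. f z \<partial>kendall_dirac \<alpha> x y \<partial>L2 \<partial>L1)"
  proof (rule nn_integral_cong)
    fix x
    assume "x \<in> space L1"
    then have "kendall_dirac \<alpha> x \<in> L2 \<rightarrow>\<^sub>M subprob_algebra borel"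
      using measurable_compose[OF measurable_Pair1' kernel] by simp
    then show "(\<integral>\<^sup>+z. f z \<partial>(L2 \<bind> kendall_dirac \<alpha> x))
        = (\<integral>\<^sup>+y. \<integral>\<^sup>+z. f z \<partial>kendall_dirac \<alpha> x y \<partial>L2)"
      by (intro nn_integral_bind[where B = borel]) auto
  qed
  finally show ?thesis .
qed

section \<open>Truncated mass and moment of convolutions and their powers\<close>

text \<open>This is h(t) of the overview, namely t^(-\<alpha>) H(t), for an arbitrary law L.
  Dividing by t inside the power keeps the integrand at most 1, so it is integrable for every
  probability law on the reals.\<close>

definition trunc_moment :: "real \<Rightarrow> real \<Rightarrow> real measure \<Rightarrow> real" where
  "trunc_moment \<alpha> t L = (LINT x|L. (x / t) powr \<alpha> * indicator {0..t} x)"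

lemma (in real_distribution) integrable_trunc_moment:
  assumes "0 < t" "0 \<le> \<alpha>"
  shows "integrable M (\<lambda>x. (x / t) powr \<alpha> * indicator {0..t} x)"
proof (rule integrable_const_bound[where B = 1])
  show "AE x in M. norm ((x / t) powr \<alpha> * indicator {0..t} x) \<le> 1"
    using assms by (auto intro!: AE_I2 powr_ratio_le_1 split: split_indicator)
qed simp

lemma (in real_distribution) has_bochner_integral_kendall_test:
  assumes "0 < t" "0 \<le> \<alpha>"
  shows "has_bochner_integral M (kendall_test \<alpha> t d) (measure M {0..t} - d * trunc_moment \<alpha> t M)"
proof -
  have eq: "kendall_test \<alpha> t d = (\<lambda>x. indicator {0..t} x - d * ((x / t) powr \<alpha> * indicator {0..t} x))"
    by (rule ext) (simp add: kendall_test_def algebra_simps)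
  have "has_bochner_integral M (indicator {0..t}) (measure M {0..t})"
    by (intro has_bochner_integral_real_indicator) (auto simp: emeasure_eq_measure)
  moreover have "has_bochner_integral M (\<lambda>x. (x / t) powr \<alpha> * indicator {0..t} x) (trunc_moment \<alpha> t M)"
    using integrable_trunc_moment[OF assms] by (simp add: has_bochner_integral_iff trunc_moment_def)
  ultimately show ?thesis
    unfolding eq by (intro has_bochner_integral_diff has_bochner_integral_mult_right)
qed

lemma (in real_distribution) nn_integral_kendall_test:
  assumes "0 < t" "0 \<le> \<alpha>" "0 \<le> d" "d \<le> 1"
  shows "(\<integral>\<^sup>+x. ennreal (kendall_test \<alpha> t d x) \<partial>M)
    = ennreal (measure M {0..t} - d * trunc_moment \<alpha> t M)"
    and "0 \<le> measure M {0..t} - d * trunc_moment \<alpha> t M"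
proof -
  have nonneg: "0 \<le> kendall_test \<alpha> t d x" for x
    using assms powr_ratio_le_1[of x t \<alpha>]
    by (auto simp: kendall_test_def intro: mult_le_one split: split_indicator)
  note int = has_bochner_integral_kendall_test[OF assms(1,2), of d]
  show "(\<integral>\<^sup>+x. ennreal (kendall_test \<alpha> t d x) \<partial>M)
    = ennreal (measure M {0..t} - d * trunc_moment \<alpha> t M)"
    using nn_integral_eq_integral[of M "kendall_test \<alpha> t d"] int nonneg
    by (simp add: has_bochner_integral_iff)
  have "0 \<le> integral\<^sup>L M (kendall_test \<alpha> t d)"
    by (intro Bochner_Integration.integral_nonneg nonneg)
  then show "0 \<le> measure M {0..t} - d * trunc_moment \<alpha> t M"
    using int by (simp add: has_bochner_integral_iff)
qed

text \<open>By \<open>nn_integral_kendall_dirac_test\<close> the inner integral is a sum of products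
  of a function of x and a function of y. Integration therefore replaces each indicator by a mass P
  and each weighted indicator by a moment Q.\<close>

lemma kendall_conv_test:
  assumes "\<alpha> > 0" "L1 \<in> nonneg_borel_probs" "L2 \<in> nonneg_borel_probs" "0 < t" "0 \<le> d" "d \<le> 1"
  defines "P \<equiv> \<lambda>L. measure L {0..t}" and "Q \<equiv> trunc_moment \<alpha> t"
  shows "P (kendall_conv \<alpha> L1 L2) - d * Q (kendall_conv \<alpha> L1 L2)
    = P L1 * P L2 - d * (Q L1 * P L2 + P L1 * Q L2) + (2 * d - 1) * (Q L1 * Q L2)"
proof -
  interpret L1: real_distribution L1 using assms by (simp add: nonneg_borel_probs_def)
  interpret L2: real_distribution L2 using assms by (simp add: nonneg_borel_probs_def)
  interpret L12: real_distribution "kendall_conv \<alpha> L1 L2"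
    using kendall_conv_nonneg_borel_probs[OF assms(1)] assms(2,3) by (simp add: nonneg_borel_probs_def)
  note i1 = L1.integrable_trunc_moment[OF assms(4) less_imp_le[OF assms(1)]]
  note i2 = L2.integrable_trunc_moment[OF assms(4) less_imp_le[OF assms(1)]]
  define p where "p = (indicator {0..t} :: real \<Rightarrow> real)"
  define q where "q = (\<lambda>x. (x / t) powr \<alpha> * p x)"
  \<comment> \<open>B is that inner integral with the indicators absorbed into p and q; below, C
    integrates out y and D then integrates out x. Their nonnegativity links Bochner and nonnegative
    integrals and finally lets \<open>ennreal\<close> be cancelled.\<close>
  define B where "B = (\<lambda>x y. p x * p y - d * (q x * p y) - d * (p x * q y) + (2 * d - 1) * (q x * q y))"
  have ints: "integrable L1 p" "integrable L2 p" "integrable L1 q" "integrable L2 q"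
    using i1 i2 by (auto simp: p_def q_def L1.emeasure_eq_measure L2.emeasure_eq_measure
        intro!: integrable_real_indicator)
  have PQ: "integral\<^sup>L L1 p = P L1" "integral\<^sup>L L2 p = P L2"
    "integral\<^sup>L L1 q = Q L1" "integral\<^sup>L L2 q = Q L2"
    by (auto simp: P_def Q_def p_def q_def trunc_moment_def)
  have B_nonneg: "0 \<le> B x y" for x y
  proof (cases "x \<in> {0..t} \<and> y \<in> {0..t}")
    case True
    let ?u = "(x / t) powr \<alpha>" and ?v = "(y / t) powr \<alpha>"
    have uv: "?u \<le> 1" "?v \<le> 1"
      using True assms by (auto intro: powr_ratio_le_1)
    \<comment> \<open>A convex combination of the kernels for d = 0 and d = 1, both nonnegative
      because \<open>?u\<close> and \<open>?v\<close> are at most 1.\<close>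
    have "B x y = (1 - d) * (1 - ?u * ?v) + d * ((1 - ?u) * (1 - ?v))"
      using True by (simp add: B_def p_def q_def algebra_simps)
    moreover have "\<dots> \<ge> 0"
      using uv assms mult_le_one[of ?u ?v] by (intro add_nonneg_nonneg mult_nonneg_nonneg) auto
    ultimately show ?thesis by simp
  qed (auto simp: B_def q_def p_def)
  \<comment> \<open>The formula for the inner integral is stated for nonnegative points, so the
    integrands are compared almost everywhere.\<close>
  have AE: "AE x in L1. 0 \<le> x" "AE y in L2. 0 \<le> y"
    using assms by (auto simp: nonneg_borel_probs_iff)
  define C where "C = (\<lambda>x. p x * P L2 - d * (q x * P L2) - d * (p x * Q L2) + (2 * d - 1) * (q x * Q L2))"
  have B_int: "integrable L2 (B x)" "integral\<^sup>L L2 (B x) = C x" for x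
    unfolding B_def C_def using ints PQ by auto
  have C_nonneg: "0 \<le> C x" for x
    using Bochner_Integration.integral_nonneg[of L2 "B x"] B_nonneg B_int by simp
  define D where "D = P L1 * P L2 - d * (Q L1 * P L2) - d * (P L1 * Q L2) + (2 * d - 1) * (Q L1 * Q L2)"
  have C_int: "integrable L1 C" "integral\<^sup>L L1 C = D"
    unfolding C_def D_def using ints PQ by auto
  have D_nonneg: "0 \<le> D"
    using Bochner_Integration.integral_nonneg[of L1 C] C_nonneg C_int by simp
  have "(\<integral>\<^sup>+z. ennreal (kendall_test \<alpha> t d z) \<partial>kendall_conv \<alpha> L1 L2)
      = (\<integral>\<^sup>+x. \<integral>\<^sup>+y. \<integral>\<^sup>+z. ennreal (kendall_test \<alpha> t d z) \<partial>kendall_dirac \<alpha> x y \<partial>L2 \<partial>L1)"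
    using assms by (intro nn_integral_kendall_conv) (auto simp: nonneg_borel_probs_def)
  also have "\<dots> = (\<integral>\<^sup>+x. \<integral>\<^sup>+y. ennreal (B x y) \<partial>L2 \<partial>L1)"
  proof (rule nn_integral_cong_AE)
    show "AE x in L1. (\<integral>\<^sup>+y. \<integral>\<^sup>+z. ennreal (kendall_test \<alpha> t d z) \<partial>kendall_dirac \<alpha> x y \<partial>L2)
        = (\<integral>\<^sup>+y. ennreal (B x y) \<partial>L2)"
      using AE(1)
    proof eventually_elim
      case (elim x)
      show ?case
      proof (rule nn_integral_cong_AE)
        show "AE y in L2. (\<integral>\<^sup>+z. ennreal (kendall_test \<alpha> t d z) \<partial>kendall_dirac \<alpha> x y) = ennreal (B x y)"
          using AE(2)
        proof eventually_elim
          case (elim y)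
          have "(1 - d * (x / t) powr \<alpha> - d * (y / t) powr \<alpha>
              + (2 * d - 1) * ((x / t) powr \<alpha> * (y / t) powr \<alpha>))
              * indicator {0..t} x * indicator {0..t} y = B x y"
            by (simp add: B_def q_def p_def algebra_simps)
          then show ?case
            using nn_integral_kendall_dirac_test[OF assms(1) \<open>0 \<le> x\<close> elim assms(4-6)] by simp
        qed
      qed
    qed
  qed
  also have "\<dots> = (\<integral>\<^sup>+x. ennreal (C x) \<partial>L1)"
    using nn_integral_eq_integral[OF B_int(1)] B_nonneg B_int(2) by simp
  also have "\<dots> = ennreal D"
    using nn_integral_eq_integral[OF C_int(1)] C_nonneg C_int(2) by simp
  finally have "ennreal (P (kendall_conv \<alpha> L1 L2) - d * Q (kendall_conv \<alpha> L1 L2)) = ennreal D"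
    using L12.nn_integral_kendall_test(1)[of t \<alpha> d] assms by (simp add: P_def Q_def)
  then show ?thesis
    using D_nonneg L12.nn_integral_kendall_test(2)[of t \<alpha> d] assms
    by (simp add: P_def Q_def D_def algebra_simps)
qed

text \<open>Two values of d determine two unknowns: d = 0 isolates P, and d = 1 says that P - Q,
  which is \<open>kendall_G\<close>, is multiplicative. Subtraction gives Q.\<close>

lemma kendall_conv_mass_moment:
  assumes "\<alpha> > 0" "L1 \<in> nonneg_borel_probs" "L2 \<in> nonneg_borel_probs" "0 < t"
  defines "P \<equiv> \<lambda>L. measure L {0..t}" and "Q \<equiv> trunc_moment \<alpha> t"
  shows "P (kendall_conv \<alpha> L1 L2) = P L1 * P L2 - Q L1 * Q L2"
    and "Q (kendall_conv \<alpha> L1 L2) = Q L1 * P L2 + P L1 * Q L2 - 2 * (Q L1 * Q L2)"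
  using kendall_conv_test[OF assms(1-4), of 0] kendall_conv_test[OF assms(1-4), of 1]
  by (auto simp: P_def Q_def)

text \<open>Let P and Q be mass and moment of the n-th power. Multiplicativity gives P - Q = g^n, so
  the rule for Q at the next power becomes Q' = g Q + h g^n. Starting from Q = 0 for the point mass
  at 0, the solution is n h g^(n-1).\<close>

lemma kendall_power_mass_moment:
  assumes "\<alpha> > 0" "\<nu> \<in> nonneg_borel_probs" "0 < t"
  defines "h \<equiv> trunc_moment \<alpha> t \<nu>"
  defines "g \<equiv> measure \<nu> {0..t} - h"
  shows "measure (kendall_power \<alpha> \<nu> n) {0..t} = g ^ n + real n * h * g ^ (n - 1)"
    and "trunc_moment \<alpha> t (kendall_power \<alpha> \<nu> n) = real n * h * g ^ (n - 1)"
proof (induction n)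
  case 0
  have "trunc_moment \<alpha> t (return borel 0) = 0"
    unfolding trunc_moment_def using assms(3) by (subst integral_return) auto
  then show "measure (kendall_power \<alpha> \<nu> 0) {0..t} = g ^ 0 + real 0 * h * g ^ (0 - 1)"
    "trunc_moment \<alpha> t (kendall_power \<alpha> \<nu> 0) = real 0 * h * g ^ (0 - 1)"
    using assms(3) by (auto simp: measure_return)
next
  case (Suc n)
  note * = kendall_conv_mass_moment[OF assms(1,2) kendall_power_nonneg_borel_probs[OF assms(1,2)] assms(3), of n]
  have \<nu>: "measure \<nu> {0..t} = g + h" by (simp add: g_def)
  \<comment> \<open>For n = 0 the exponent n - 1 is truncated to 0, but the factor n makes both
    sides vanish.\<close>
  have "real n * h * g ^ (n - 1) * g = real n * h * g ^ n"
    by (cases n) auto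
  then show "measure (kendall_power \<alpha> \<nu> (Suc n)) {0..t}
      = g ^ Suc n + real (Suc n) * h * g ^ (Suc n - 1)"
    "trunc_moment \<alpha> t (kendall_power \<alpha> \<nu> (Suc n)) = real (Suc n) * h * g ^ (Suc n - 1)"
    using *[folded h_def] unfolding Suc \<nu> by (simp_all add: algebra_simps)
qed

section \<open>The random walk and its renewal process\<close>

lemma measure_atMost_eq:
  assumes "L \<in> nonneg_borel_probs"
  shows "measure L {..t} = measure L {0..t}"
  using assms by (intro measure_eq_AE) (auto simp: nonneg_borel_probs_iff real_distribution_def
      real_distribution_axioms_def)

text \<open>A point mass at x > t has mass 0 and moment 0 on \<open>{0..t}\<close>, so the bilinear
  formula for the mass of the convolution gives 0. This is why the walk does not come back below a
  level it has exceeded.\<close>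

lemma emeasure_kendall_conv_return_below:
  assumes "\<alpha> > 0" "L \<in> nonneg_borel_probs" "0 < t" "t < x"
  shows "emeasure (kendall_conv \<alpha> (return borel x) L) {..t} = 0"
proof -
  have x: "return borel x \<in> nonneg_borel_probs"
    using assms by (intro return_nonneg_borel_probs) simp
  interpret K: real_distribution "kendall_conv \<alpha> (return borel x) L"
    using kendall_conv_nonneg_borel_probs[OF assms(1)] x assms(2) by (simp add: nonneg_borel_probs_def)
  have zero: "measure (return borel x) {0..t} = 0" "trunc_moment \<alpha> t (return borel x) = 0"
    using assms by (auto simp: measure_return trunc_moment_def integral_return)
  have "measure (kendall_conv \<alpha> (return borel x) L) {0..t} = 0"
    using kendall_conv_mass_moment(1)[OF assms(1) x assms(2,3)] zero by simp
  moreover have "measure (kendall_conv \<alpha> (return borel x) L) {..t}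
      = measure (kendall_conv \<alpha> (return borel x) L) {0..t}"
    by (intro measure_atMost_eq kendall_conv_nonneg_borel_probs nonneg_borel_probs_real_distribution x assms)
  ultimately show ?thesis by (simp add: K.emeasure_eq_measure)
qed

lemma walk_history_subalgebra:
  assumes "\<And>n. 1 \<le> n \<Longrightarrow> S n \<in> borel_measurable M"
  shows "subalgebra M (walk_history M S k)"
proof -
  have "{S i -` A \<inter> space M | i A. 1 \<le> i \<and> i \<le> k \<and> A \<in> sets borel} \<subseteq> sets M"
    using assms by (auto intro: measurable_sets)
  then show ?thesis
    unfolding subalgebra_def walk_history_def
    by (auto simp: space_measure_of_conv sets_measure_of_conv intro: sets.sigma_sets_subset[THEN subsetD])
qed

lemma walk_history_sets:
  assumes "1 \<le> i" "i \<le> k" "A \<in> sets borel"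
  shows "S i -` A \<inter> space M \<in> sets (walk_history M S k)"
  unfolding walk_history_def using assms
  by (subst sets_measure_of) (auto intro!: sigma_sets.Basic)

lemma borel_measurable_emeasure_kendall_dirac:
  assumes "\<alpha> > 0" "real_distribution L" "A \<in> sets borel"
  shows "(\<lambda>x. \<integral>\<^sup>+y. emeasure (kendall_dirac \<alpha> x y) A \<partial>L) \<in> borel_measurable borel"
proof -
  interpret real_distribution L by fact
  have "(\<lambda>a. emeasure (case a of (x, y) \<Rightarrow> kendall_dirac \<alpha> x y) A) \<in> borel_measurable (borel \<Otimes>\<^sub>M borel)"
    using measurable_kendall_dirac_subprob[OF assms(1)] assms(3)
    by (rule measurable_emeasure_kernel)
  then have "(\<lambda>(x, y). emeasure (kendall_dirac \<alpha> x y) A) \<in> borel_measurable (borel \<Otimes>\<^sub>M L)"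
    by (simp add: case_prod_beta cong: measurable_cong_sets sets_pair_measure_cong)
  then show ?thesis by (rule borel_measurable_nn_integral)
qed

lemma emeasure_kendall_conv_return:
  assumes "\<alpha> > 0" "real_distribution L" "A \<in> sets borel"
  shows "emeasure (kendall_conv \<alpha> (return borel x) L) A = (\<integral>\<^sup>+y. emeasure (kendall_dirac \<alpha> x y) A \<partial>L)"
  using emeasure_kendall_conv[OF assms(1) real_distribution_return assms(2,3)]
    borel_measurable_emeasure_kendall_dirac[OF assms]
  by (simp add: nn_integral_return)

lemma renewal_process_le_iff:
  "renewal_process S t \<omega> \<le> enat k \<longleftrightarrow> (\<exists>j\<le>k. t < S (Suc j) \<omega>)"
proof -
  \<comment> \<open>An infimum is characterised by strict upper bounds, and for values in
    \<open>enat\<close> being at most k means being below k + 1.\<close>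
  have "renewal_process S t \<omega> \<le> enat k \<longleftrightarrow> renewal_process S t \<omega> < enat (Suc k)"
    by (cases "renewal_process S t \<omega>") auto
  then show ?thesis
    unfolding renewal_process_def INF_less_iff by (auto simp: less_Suc_eq_le)
qed

section \<open>Markov property, marginal laws and first passage of the walk\<close>

context
  fixes M :: "'a measure" and \<alpha> :: real and \<nu> :: "real measure" and S :: "nat \<Rightarrow> 'a \<Rightarrow> real"
  assumes \<alpha>: "\<alpha> > 0" and \<nu>: "\<nu> \<in> nonneg_borel_probs" and walk: "kendall_random_walk M \<alpha> \<nu> S"
begin

lemma walk_prob_space: "prob_space M"
  and walk_measurable: "1 \<le> n \<Longrightarrow> S n \<in> borel_measurable M"
  and walk_step: "distr M borel (S 1) = \<nu>"
  using walk by (auto simp: kendall_random_walk_def)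

text \<open>Integrating the conditional expectation over an event B of the history turns the almost
  sure Markov identity into an identity of measures.\<close>

lemma walk_markov:
  assumes "1 \<le> k" "k < n" "A \<in> sets borel" "B \<in> sets (walk_history M S k)"
  shows "emeasure M (B \<inter> S n -` A)
    = (\<integral>\<^sup>+\<omega>. emeasure (kendall_conv \<alpha> (return borel (S k \<omega>)) (kendall_power \<alpha> \<nu> (n - k))) A
        * indicator B \<omega> \<partial>M)"
proof -
  interpret prob_space M by (rule walk_prob_space)
  let ?F = "walk_history M S k"
  interpret F: finite_measure_subalgebra M ?F
    by standard (rule walk_history_subalgebra[OF walk_measurable])
  let ?K = "\<lambda>\<omega>. measure (kendall_conv \<alpha> (return borel (S k \<omega>)) (kendall_power \<alpha> \<nu> (n - k))) A"
  have [measurable]: "S n \<in> borel_measurable M"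
    using assms by (intro walk_measurable) simp
  have nA [measurable]: "S n -` A \<inter> space M \<in> sets M"
    using assms(3) by measurable
  have BM [measurable]: "B \<in> sets M"
    using assms(4) F.subalg by (auto simp: subalgebra_def)
  let ?I = "indicator (S n -` A \<inter> space M) :: 'a \<Rightarrow> real"
  have AE: "AE \<omega> in M. real_cond_exp M ?F ?I \<omega> = ?K \<omega>"
    using walk assms(1-3) by (auto simp: kendall_random_walk_def)
  have int: "integrable M ?I"
    by (intro integrable_real_indicator) (auto simp: emeasure_eq_measure)
  have sets_eq: "B \<inter> S n -` A = B \<inter> (S n -` A \<inter> space M)"
    using sets.sets_into_space[OF BM] by auto
  have "measure M (B \<inter> S n -` A) = (LINT \<omega>:B|M. ?I \<omega>)"
    unfolding sets_eq set_lebesgue_integral_def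
    by (simp add: indicator_inter_arith[symmetric] sets.Int)
  also have "\<dots> = (LINT \<omega>:B|M. real_cond_exp M ?F ?I \<omega>)"
    using F.real_cond_exp_intA[OF int assms(4)] .
  finally have 1: "measure M (B \<inter> S n -` A) = (LINT \<omega>|M. indicator B \<omega> * real_cond_exp M ?F ?I \<omega>)"
    by (simp add: set_lebesgue_integral_def)
  have int2: "integrable M (\<lambda>\<omega>. indicator B \<omega> * real_cond_exp M ?F ?I \<omega>)"
    using integrable_mult_indicator[OF BM F.real_cond_exp_int(1)[OF int]] by simp
  have "emeasure M (B \<inter> S n -` A) = ennreal (LINT \<omega>|M. indicator B \<omega> * real_cond_exp M ?F ?I \<omega>)"
    by (simp add: emeasure_eq_measure 1)
  \<comment> \<open>The conditional expectation is nonnegative almost everywhere because it agrees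
    there with the measure of a set.\<close>
  also have "\<dots> = (\<integral>\<^sup>+\<omega>. ennreal (indicator B \<omega> * real_cond_exp M ?F ?I \<omega>) \<partial>M)"
    using int2 AE by (intro nn_integral_eq_integral[symmetric]) (auto elim!: eventually_mono)
  also have "\<dots> = (\<integral>\<^sup>+\<omega>. emeasure (kendall_conv \<alpha> (return borel (S k \<omega>)) (kendall_power \<alpha> \<nu> (n - k))) A
        * indicator B \<omega> \<partial>M)"
  proof (rule nn_integral_cong_AE)
    have "emeasure (kendall_conv \<alpha> (return borel x) (kendall_power \<alpha> \<nu> m)) A
      = ennreal (measure (kendall_conv \<alpha> (return borel x) (kendall_power \<alpha> \<nu> m)) A)" for x m
    proof -
      interpret K: real_distribution "kendall_conv \<alpha> (return borel x) (kendall_power \<alpha> \<nu> m)"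
        by (intro nonneg_borel_probs_real_distribution kendall_conv_nonneg_borel_probs \<alpha>
            real_distribution_return kendall_power_nonneg_borel_probs \<nu>)
      show ?thesis by (rule K.emeasure_eq_measure)
    qed
    note eq = this
    show "AE \<omega> in M. ennreal (indicator B \<omega> * real_cond_exp M ?F ?I \<omega>)
        = emeasure (kendall_conv \<alpha> (return borel (S k \<omega>)) (kendall_power \<alpha> \<nu> (n - k))) A
          * indicator B \<omega>"
      using AE by eventually_elim (auto simp: eq split: split_indicator)
  qed
  finally show ?thesis .
qed

text \<open>The Markov identity is applied at time 1 with the whole space as history event. Since S
  1 has law \<nu>, averaging the transition law over the starting point gives the convolution of
  \<nu> with the n-th power, which is the recursive definition of the next power.\<close>

lemma walk_law:
  assumes "1 \<le> n" "A \<in> sets borel"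
  shows "emeasure M (space M \<inter> S (Suc n) -` A) = emeasure (kendall_power \<alpha> \<nu> (Suc n)) A"
proof -
  note L = nonneg_borel_probs_real_distribution[OF kendall_power_nonneg_borel_probs[OF \<alpha> \<nu>], of n]
  have S1: "S 1 \<in> borel_measurable M" by (simp add: walk_measurable)
  have "space M \<in> sets (walk_history M S 1)"
    using walk_history_sets[of 1 1 UNIV S M] by simp
  then have "emeasure M (space M \<inter> S (Suc n) -` A)
      = (\<integral>\<^sup>+\<omega>. emeasure (kendall_conv \<alpha> (return borel (S 1 \<omega>)) (kendall_power \<alpha> \<nu> n)) A
        * indicator (space M) \<omega> \<partial>M)"
    using assms walk_markov[of 1 "Suc n" A "space M"] by simp
  also have "\<dots> = (\<integral>\<^sup>+\<omega>. emeasure (kendall_conv \<alpha> (return borel (S 1 \<omega>)) (kendall_power \<alpha> \<nu> n)) A \<partial>M)"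
    by (intro nn_integral_cong) simp
  also have "\<dots> = (\<integral>\<^sup>+x. \<integral>\<^sup>+y. emeasure (kendall_dirac \<alpha> x y) A \<partial>kendall_power \<alpha> \<nu> n
      \<partial>distr M borel (S 1))"
    using borel_measurable_emeasure_kendall_dirac[OF \<alpha> L assms(2)] S1
    by (simp add: emeasure_kendall_conv_return[OF \<alpha> L assms(2)] nn_integral_distr)
  also have "\<dots> = emeasure (kendall_power \<alpha> \<nu> (Suc n)) A"
    unfolding walk_step kendall_power.simps
    by (intro emeasure_kendall_conv[symmetric] \<alpha> L assms nonneg_borel_probs_real_distribution \<nu>)
  finally show ?thesis .
qed

lemma walk_cdf:
  assumes "0 < t"
  defines "h \<equiv> trunc_moment \<alpha> t \<nu>"
  defines "g \<equiv> measure \<nu> {0..t} - h"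
  shows "measure M {\<omega>\<in>space M. S (Suc n) \<omega> \<le> t} = g ^ Suc n + real (Suc n) * h * g ^ n"
proof -
  have set: "{\<omega>\<in>space M. S (Suc n) \<omega> \<le> t} = space M \<inter> S (Suc n) -` {..t}" by auto
  show ?thesis
  proof (cases "n = 0")
    \<comment> \<open>At time 1 the law is \<nu> by assumption, while \<open>walk_law\<close> starts
      at time 2. The claim reduces to g + h being the mass of \<open>{0..t}\<close>.\<close>
    case True
    have "measure M {\<omega>\<in>space M. S (Suc n) \<omega> \<le> t} = measure (distr M borel (S 1)) {..t}"
      unfolding set using walk_measurable[of 1] True by (subst measure_distr) (auto simp: Int_commute)
    then show ?thesis
      using True measure_atMost_eq[OF \<nu>] by (simp add: walk_step g_def del: One_nat_def)
  next
    case False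
    then have "measure M {\<omega>\<in>space M. S (Suc n) \<omega> \<le> t} = measure (kendall_power \<alpha> \<nu> (Suc n)) {..t}"
      unfolding set measure_def using walk_law[of n "{..t}"] by simp
    also have "\<dots> = measure (kendall_power \<alpha> \<nu> (Suc n)) {0..t}"
      by (intro measure_atMost_eq kendall_power_nonneg_borel_probs \<alpha> \<nu>)
    finally show ?thesis
      using kendall_power_mass_moment(1)[OF \<alpha> \<nu> assms(1), of "Suc n"] by (simp add: g_def h_def)
  qed
qed

text \<open>The event that the walk is above t at time n but not at time n + 1 is measured by
  integrating transition laws that vanish on \<open>{..t}\<close>; the countably many null events
  are discarded together. A passage above t can then be detected at a single time.\<close>

lemma walk_stays_above:
  assumes "0 < t"
  shows "AE \<omega> in M. \<forall>n\<ge>1. t < S n \<omega> \<longrightarrow> t < S (Suc n) \<omega>"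
proof -
  have "AE \<omega> in M. t < S n \<omega> \<longrightarrow> t < S (Suc n) \<omega>" if n: "1 \<le> n" for n
  proof -
    have [measurable]: "S n \<in> borel_measurable M" "S (Suc n) \<in> borel_measurable M"
      using n by (auto intro: walk_measurable)
    let ?B = "S n -` {t<..} \<inter> space M"
    have "emeasure M (?B \<inter> S (Suc n) -` {..t})
      = (\<integral>\<^sup>+\<omega>. emeasure (kendall_conv \<alpha> (return borel (S n \<omega>)) (kendall_power \<alpha> \<nu> (Suc n - n))) {..t}
        * indicator ?B \<omega> \<partial>M)"
      using n by (intro walk_markov walk_history_sets) auto
    also have "\<dots> = (\<integral>\<^sup>+\<omega>. 0 \<partial>M)"
      using emeasure_kendall_conv_return_below[OF \<alpha> kendall_power_nonneg_borel_probs[OF \<alpha> \<nu>] assms]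
      by (intro nn_integral_cong) (auto simp del: kendall_power.simps split: split_indicator)
    finally have "emeasure M (?B \<inter> S (Suc n) -` {..t}) = 0" by simp
    moreover have "?B \<inter> S (Suc n) -` {..t} = {\<omega>\<in>space M. \<not> (t < S n \<omega> \<longrightarrow> t < S (Suc n) \<omega>)}"
      by auto
    ultimately show ?thesis
      by (intro AE_I[OF order_refl]) auto
  qed
  then show ?thesis by (simp add: AE_all_countable)
qed

lemma renewal_cdf:
  assumes "0 < t"
  defines "h \<equiv> trunc_moment \<alpha> t \<nu>"
  defines "g \<equiv> measure \<nu> {0..t} - h"
  shows "measure M {\<omega>\<in>space M. renewal_process S t \<omega> \<le> enat k} = 1 - (g ^ Suc k + real (Suc k) * h * g ^ k)"
proof -
  interpret prob_space M by (rule walk_prob_space)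
  have [measurable]: "S (Suc n) \<in> borel_measurable M" for n
    by (intro walk_measurable) simp
  have "AE \<omega> in M. renewal_process S t \<omega> \<le> enat k \<longleftrightarrow> \<not> S (Suc k) \<omega> \<le> t"
    using walk_stays_above[OF assms(1)]
  proof eventually_elim
    case (elim \<omega>)
    \<comment> \<open>A passage at index j persists up to index k, so the event depends only on the
      walk at time k + 1.\<close>
    have "t < S (Suc k) \<omega>" if "j \<le> k" "t < S (Suc j) \<omega>" for j
      using that by (induction k rule: dec_induct) (use elim in auto)
    then show ?case by (auto simp: renewal_process_le_iff not_le)
  qed
  then have "prob {\<omega>\<in>space M. renewal_process S t \<omega> \<le> enat k} = prob {\<omega>\<in>space M. \<not> S (Suc k) \<omega> \<le> t}"
    by (intro measure_eq_AE) (auto simp: renewal_process_le_iff)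
  also have "\<dots> = 1 - prob {\<omega>\<in>space M. S (Suc k) \<omega> \<le> t}"
    by (intro prob_neg) simp
  finally show ?thesis
    using walk_cdf[OF assms(1)] by (simp add: g_def h_def)
qed

end

section \<open>Regular variation\<close>

text \<open>Regular variation at the ratio 2 bounds the growth over one doubling by 2^\<beta> beyond
  some T. Iteration handles powers of 2, and monotonicity the points between them. The factor 2 in
  \<open>(2 * s) powr \<beta>\<close> pays for rounding s up to a power of 2.\<close>

lemma regularly_varying_mono_bound:
  assumes "regularly_varying \<theta> f" "mono_on {0<..} f" "\<theta> < \<beta>" "0 \<le> \<beta>"
  shows "\<forall>\<^sub>F t in at_top. \<forall>s\<ge>1. f (t * s) \<le> (2 * s) powr \<beta> * f t"
proof -
  have "((\<lambda>t. f (t * 2) / f t) \<longlongrightarrow> 2 powr \<theta>) at_top"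
    using assms(1) by (auto simp: regularly_varying_def)
  then have "\<forall>\<^sub>F t in at_top. f (t * 2) / f t < 2 powr \<beta>"
    using assms(3) by (intro order_tendstoD) auto
  moreover have "\<forall>\<^sub>F t in at_top. f t > 0"
    using assms(1) by (auto simp: regularly_varying_def)
  ultimately have "\<forall>\<^sub>F t in at_top. f (t * 2) \<le> 2 powr \<beta> * f t \<and> f t > 0"
    by eventually_elim (auto simp: field_simps)
  then obtain T where T: "\<And>t. T \<le> t \<Longrightarrow> f (t * 2) \<le> 2 powr \<beta> * f t \<and> f t > 0"
    by (auto simp: eventually_at_top_linorder)
  have "f (t * s) \<le> (2 * s) powr \<beta> * f t" if t: "T \<le> t" "0 < t" and s: "1 \<le> s" for t s
  proof -
    have pow: "f (t * 2 ^ n) \<le> (2 ^ n) powr \<beta> * f t" for n :: nat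
    proof (induction n)
      case (Suc n)
      have "t * 1 \<le> t * 2 ^ n"
        using t by (intro mult_left_mono) auto
      then have "T \<le> t * 2 ^ n"
        using t(1) by linarith
      then have "f (t * 2 ^ Suc n) \<le> 2 powr \<beta> * f (t * 2 ^ n)"
        using T[of "t * 2 ^ n"] t by (simp add: ac_simps)
      also have "\<dots> \<le> 2 powr \<beta> * ((2 ^ n) powr \<beta> * f t)"
        using Suc by (intro mult_left_mono) auto
      also have "\<dots> = (2 ^ Suc n) powr \<beta> * f t"
        by (simp add: powr_mult)
      finally show ?case .
    qed simp
    \<comment> \<open>Powers of 2 are integers, so bracketing the integer part m by them also
      brackets s: \<open>m + 1\<close> is at most \<open>2 ^ Suc n\<close> and s is below
      \<open>m + 1\<close>.\<close>
    define m where "m = nat \<lfloor>s\<rfloor>"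
    have m: "real m \<le> s" "s < real m + 1" "1 \<le> m"
      using s unfolding m_def by linarith+
    obtain n where "2 ^ n \<le> m" "m + 1 \<le> 2 ^ Suc n"
      using ex_power_ivl1[of 2 m] m(3) by auto
    then have "real (2 ^ n) \<le> real m" "real (m + 1) \<le> real (2 ^ Suc n)"
      unfolding of_nat_le_iff .
    then have "2 ^ n \<le> real m" "real m + 1 \<le> 2 ^ Suc n"
      by (simp_all only: of_nat_power of_nat_numeral of_nat_add of_nat_1)
    then have n: "2 ^ n \<le> s" "s < 2 ^ Suc n"
      using m by linarith+
    have "f (t * s) \<le> f (t * 2 ^ Suc n)"
      using t s n by (intro mono_onD[OF assms(2)]) auto
    also have "\<dots> \<le> (2 ^ Suc n) powr \<beta> * f t"
      by (rule pow)
    also have "\<dots> \<le> (2 * s) powr \<beta> * f t"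
      using n T[OF t(1)] assms(4) by (intro mult_right_mono powr_mono2) auto
    finally show ?thesis .
  qed
  then show ?thesis
    by (intro eventually_at_top_linorderI[of "max T 1"]) auto
qed

lemma has_bochner_integral_powr_atLeast_1:
  fixes c :: real
  assumes "c > 0"
  shows "has_bochner_integral lborel (\<lambda>s. s powr (- c - 1) * indicator {1..} s) (1 / c)"
proof (rule has_bochner_integral_nn_integral)
  have "(\<integral>\<^sup>+s. ennreal (s powr (- c - 1)) * indicator {1..} s \<partial>lborel)
      = ennreal (0 - (- (1 powr (- c)) / c))"
  proof (rule nn_integral_FTC_atLeast)
    show "((\<lambda>s. - (s powr (- c)) / c) \<longlongrightarrow> 0) at_top"
      using assms by real_asymp
    show "((\<lambda>s. - (s powr (- c)) / c) has_real_derivative s powr (- c - 1)) (at s)" if "1 \<le> s" for s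
      using that assms by (auto intro!: derivative_eq_intros)
  qed auto
  then show "(\<integral>\<^sup>+s. ennreal (s powr (- c - 1) * indicator {1..} s) \<partial>lborel) = ennreal (1 / c)"
    by (simp add: indicator_mult_ennreal mult.commute)
qed (use assms in auto)

lemma Karamata_tail_integral:
  assumes "regularly_varying \<theta> f" "mono_on {0<..} f" "\<And>t. 0 < t \<Longrightarrow> 0 \<le> f t" "0 \<le> \<theta>" "\<theta> < \<alpha>"
  shows "((\<lambda>t. LINT s|lborel. \<alpha> * s powr (- \<alpha> - 1) * (f (t * s) / f t) * indicator {1..} s)
    \<longlongrightarrow> \<alpha> / (\<alpha> - \<theta>)) at_top"
proof -
  \<comment> \<open>The midpoint lies above \<theta>, as the growth bound requires, and below
    \<alpha>, so that the dominating function \<open>?w\<close>, of order s^(\<beta>-\<alpha>-1), is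
    integrable on \<open>{1..}\<close>.\<close>
  define \<beta> where "\<beta> = (\<theta> + \<alpha>) / 2"
  have \<beta>: "\<theta> < \<beta>" "0 \<le> \<beta>" "\<beta> < \<alpha>" using assms by (auto simp: \<beta>_def)
  have [measurable]: "f \<in> borel_measurable borel"
    using assms(1) by (simp add: regularly_varying_def)
  let ?lim = "\<lambda>s. \<alpha> * (s powr (- (\<alpha> - \<theta>) - 1) * indicator {1..} s)"
  let ?w = "\<lambda>s. \<alpha> * 2 powr \<beta> * (s powr (- (\<alpha> - \<beta>) - 1) * indicator {1..} s)"
  have "((\<lambda>t. LINT s|lborel. \<alpha> * s powr (- \<alpha> - 1) * (f (t * s) / f t) * indicator {1..} s)
      \<longlongrightarrow> integral\<^sup>L lborel ?lim) at_top"
  proof (rule integral_dominated_convergence_at_top)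
    show "integrable lborel ?w"
      using has_bochner_integral_powr_atLeast_1[of "\<alpha> - \<beta>"] \<beta>
      by (intro integrable_mult_right) (auto simp: has_bochner_integral_iff)
    have "\<forall>\<^sub>F t in at_top. f t > 0"
      using assms(1) by (auto simp: regularly_varying_def)
    then show "\<forall>\<^sub>F t in at_top. AE s in lborel.
        norm (\<alpha> * s powr (- \<alpha> - 1) * (f (t * s) / f t) * indicator {1..} s) \<le> ?w s"
      using regularly_varying_mono_bound[OF assms(1,2) \<beta>(1,2)] eventually_gt_at_top[of 0]
    proof eventually_elim
      case (elim t)
      have "norm (\<alpha> * s powr (- \<alpha> - 1) * (f (t * s) / f t)) \<le> \<alpha> * 2 powr \<beta> * s powr (- (\<alpha> - \<beta>) - 1)"
        if s: "1 \<le> s" for s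
      proof -
        have le: "f (t * s) / f t \<le> (2 * s) powr \<beta>" and "0 \<le> f (t * s) / f t"
          using elim s assms(3)[of "t * s"] by (auto simp: divide_le_eq)
        then have "norm (\<alpha> * s powr (- \<alpha> - 1) * (f (t * s) / f t))
            = \<alpha> * s powr (- \<alpha> - 1) * (f (t * s) / f t)"
          unfolding real_norm_def using assms(4,5) by (intro abs_of_nonneg mult_nonneg_nonneg) auto
        also have "\<dots> \<le> \<alpha> * s powr (- \<alpha> - 1) * (2 * s) powr \<beta>"
          using assms(4,5) le by (intro mult_left_mono) auto
        also have "\<dots> = \<alpha> * 2 powr \<beta> * (s powr (- \<alpha> - 1) * s powr \<beta>)"
          using s by (simp add: powr_mult)
        also have "s powr (- \<alpha> - 1) * s powr \<beta> = s powr (- (\<alpha> - \<beta>) - 1)"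
          by (simp add: powr_add[symmetric] algebra_simps)
        finally show ?thesis .
      qed
      then show ?case
        by (intro AE_I2) (simp split: split_indicator)
    qed
    show "AE s in lborel. ((\<lambda>t. \<alpha> * s powr (- \<alpha> - 1) * (f (t * s) / f t) * indicator {1..} s)
        \<longlongrightarrow> ?lim s) at_top"
    proof (rule AE_I2)
      fix s :: real
      show "((\<lambda>t. \<alpha> * s powr (- \<alpha> - 1) * (f (t * s) / f t) * indicator {1..} s) \<longlongrightarrow> ?lim s) at_top"
      proof (cases "1 \<le> s")
        case True
        then have "((\<lambda>t. f (t * s) / f t) \<longlongrightarrow> s powr \<theta>) at_top"
          using assms(1) by (auto simp: regularly_varying_def)
        then have "((\<lambda>t. \<alpha> * s powr (- \<alpha> - 1) * (f (t * s) / f t)) \<longlongrightarrow> \<alpha> * s powr (- \<alpha> - 1) * s powr \<theta>) at_top"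
          by (intro tendsto_intros)
        moreover have "s powr (- (\<alpha> - \<theta>) - 1) = s powr (- \<alpha> - 1) * s powr \<theta>"
          by (simp add: powr_add[symmetric] algebra_simps)
        ultimately show ?thesis
          using True by (simp add: mult.assoc)
      qed simp
    qed
  qed auto
  also have "integral\<^sup>L lborel ?lim = \<alpha> / (\<alpha> - \<theta>)"
    using has_bochner_integral_powr_atLeast_1[of "\<alpha> - \<theta>"] assms by (simp add: has_bochner_integral_iff)
  finally show ?thesis .
qed

section \<open>Expressing 1 - G as a tail integral of H\<close>

text \<open>The two indicators together say that s is at least m = max 1 (x / t), so the integral
  equals c m^(-\<alpha>) with c = (x / t)^\<alpha>. This is a layer formula: integrated over x
  against \<nu>, the left side produces H(ts) and the right side 1 - G(t).\<close>

lemma nn_integral_powr_truncated: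
  assumes "\<alpha> > 0" "0 < t" "0 \<le> x"
  shows "(\<integral>\<^sup>+s. ennreal (\<alpha> * s powr (- \<alpha> - 1) * ((x / t) powr \<alpha> * indicator {0..t * s} x) * indicator {1..} s) \<partial>lborel)
    = ennreal (min 1 ((x / t) powr \<alpha>))"
proof -
  define c where "c = (x / t) powr \<alpha>"
  define m where "m = max 1 (x / t)"
  have "(\<integral>\<^sup>+s. ennreal (\<alpha> * s powr (- \<alpha> - 1) * (c * indicator {0..t * s} x) * indicator {1..} s) \<partial>lborel)
    = (\<integral>\<^sup>+s. ennreal (\<alpha> * s powr (- \<alpha> - 1) * c) * indicator {m..} s \<partial>lborel)"
  proof (rule nn_integral_cong)
    fix s
    have "indicator {0..t * s} x * indicator {1..} s = (indicator {m..} s :: real)"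
      using assms by (auto simp: m_def field_simps split: split_indicator)
    then show "ennreal (\<alpha> * s powr (- \<alpha> - 1) * (c * indicator {0..t * s} x) * indicator {1..} s)
      = ennreal (\<alpha> * s powr (- \<alpha> - 1) * c) * indicator {m..} s"
      by (simp add: mult.assoc split: split_indicator)
  qed
  also have "\<dots> = ennreal (0 - (- c * m powr (- \<alpha>)))"
  proof (rule nn_integral_FTC_atLeast)
    show "((\<lambda>s. - c * s powr (- \<alpha>)) \<longlongrightarrow> 0) at_top"
      using tendsto_mult_right_zero[OF tendsto_neg_powr[of "- \<alpha>"], of "\<lambda>x. x" at_top "- c"]
        assms by (simp add: filterlim_ident)
    show "((\<lambda>s. - c * s powr (- \<alpha>)) has_real_derivative
        \<alpha> * s powr (- \<alpha> - 1) * c) (at s)" if "m \<le> s" for s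
      using that by (auto intro!: derivative_eq_intros simp: m_def)
  qed (use assms in \<open>auto simp: c_def\<close>)
  also have "0 - (- c * m powr (- \<alpha>)) = min 1 (c)"
  proof (cases "x \<le> t")
    case True
    then have "m = 1" "c \<le> 1"
      using assms by (auto simp: m_def max_def c_def intro: powr_ratio_le_1)
    then show ?thesis by simp
  next
    case False
    then have "m = x / t" "1 < x / t" using assms by (auto simp: m_def max_def)
    moreover from this have "1 \<le> c"
      using assms unfolding c_def by (intro ge_one_powr_ge_zero) auto
    moreover have "x \<noteq> 0" "t \<noteq> 0"
      using False assms by auto
    ultimately show ?thesis
      by (simp add: c_def powr_add[symmetric])
  qed
  finally show ?thesis by (simp only: c_def)
qed

context
  fixes \<alpha> :: real and \<nu> :: "real measure"
  assumes \<alpha>: "\<alpha> > 0" and \<nu>: "\<nu> \<in> nonneg_borel_probs"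
begin

interpretation N: real_distribution \<nu>
  using \<nu> by (rule nonneg_borel_probs_real_distribution)

lemma kendall_H_eq:
  assumes "0 < t"
  shows "kendall_H \<alpha> \<nu> t = t powr \<alpha> * trunc_moment \<alpha> t \<nu>"
proof -
  have "kendall_H \<alpha> \<nu> t = (LINT x|\<nu>. t powr \<alpha> * ((x / t) powr \<alpha> * indicator {0..t} x))"
    unfolding kendall_H_def set_lebesgue_integral_def using assms
    by (intro Bochner_Integration.integral_cong) (auto simp: powr_divide split: split_indicator)
  then show ?thesis by (simp add: trunc_moment_def)
qed

lemma kendall_H_mono: "mono_on {0<..} (kendall_H \<alpha> \<nu>)"
proof (rule mono_onI)
  have int: "integrable \<nu> (\<lambda>x. indicator {0..t} x *\<^sub>R (x powr \<alpha>))" if "0 < t" for t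
  proof -
    have eq: "(\<lambda>x. indicator {0..t} x *\<^sub>R (x powr \<alpha>)) = (\<lambda>x. t powr \<alpha> * ((x / t) powr \<alpha> * indicator {0..t} x))"
      using that by (auto simp: powr_divide split: split_indicator)
    show ?thesis
      unfolding eq using N.integrable_trunc_moment[OF that, of \<alpha>] \<alpha> by (intro integrable_mult_right) auto
  qed
  fix r s :: real
  assume "r \<in> {0<..}" "s \<in> {0<..}" "r \<le> s"
  then show "kendall_H \<alpha> \<nu> r \<le> kendall_H \<alpha> \<nu> s"
    unfolding kendall_H_def set_lebesgue_integral_def
    by (intro integral_mono int) (auto split: split_indicator)
qed

lemma kendall_H_nonneg: "0 \<le> kendall_H \<alpha> \<nu> t"
  unfolding kendall_H_def set_lebesgue_integral_def
  by (intro Bochner_Integration.integral_nonneg) (auto split: split_indicator)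

text \<open>The positive part vanishes above t, which is where the test function for d = 1 is cut
  off.\<close>

lemma kendall_G_eq:
  assumes "0 < t"
  shows "kendall_G \<alpha> \<nu> t = measure \<nu> {0..t} - trunc_moment \<alpha> t \<nu>"
proof -
  have "indicator {0..} x *\<^sub>R max (1 - x powr \<alpha> / t powr \<alpha>) 0 = kendall_test \<alpha> t 1 x" for x
  proof (cases "0 \<le> x")
    case True
    then have *: "x powr \<alpha> / t powr \<alpha> = (x / t) powr \<alpha>"
      using assms by (simp add: powr_divide)
    show ?thesis
    proof (cases "x \<le> t")
      case True
      then show ?thesis
        using * \<open>0 \<le> x\<close> powr_ratio_le_1[of x t \<alpha>] assms \<alpha> by (simp add: kendall_test_def)
    next
      case False
      then have "1 \<le> (x / t) powr \<alpha>"
        using assms \<alpha> by (intro ge_one_powr_ge_zero) auto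
      then show ?thesis
        using * False by (simp add: kendall_test_def)
    qed
  qed (simp add: kendall_test_def)
  then have "kendall_G \<alpha> \<nu> t = integral\<^sup>L \<nu> (kendall_test \<alpha> t 1)"
    unfolding kendall_G_def set_lebesgue_integral_def by simp
  then show ?thesis
    using N.has_bochner_integral_kendall_test[OF assms, of \<alpha> 1] \<alpha> by (simp add: has_bochner_integral_iff)
qed

text \<open>The bounded integrand suits both dominated convergence and the exchange of integrals
  below. It equals 1 minus the test function for nonnegative x, hence \<nu>-almost
  everywhere.\<close>

lemma kendall_G_bar_eq:
  assumes "0 < t"
  shows "kendall_G_bar \<alpha> \<nu> t = (LINT x|\<nu>. min 1 ((x / t) powr \<alpha>))"
    and "integrable \<nu> (\<lambda>x. min 1 ((x / t) powr \<alpha>))"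
proof -
  have int: "has_bochner_integral \<nu> (\<lambda>x. 1 - kendall_test \<alpha> t 1 x) (1 - kendall_G \<alpha> \<nu> t)"
    using N.has_bochner_integral_kendall_test[OF assms, of \<alpha> 1] \<alpha> assms N.prob_space
      has_bochner_integral_diff[of \<nu> "\<lambda>_. 1" 1 "kendall_test \<alpha> t 1"]
    by (simp add: kendall_G_eq has_bochner_integral_iff)
  have "AE x in \<nu>. 1 - kendall_test \<alpha> t 1 x = min 1 ((x / t) powr \<alpha>)"
    using \<nu> unfolding nonneg_borel_probs_iff
  proof (elim conjE eventually_mono)
    fix x :: real
    assume x: "0 \<le> x"
    show "1 - kendall_test \<alpha> t 1 x = min 1 ((x / t) powr \<alpha>)"
    proof (cases "x \<le> t")
      case True
      then show ?thesis
        using x powr_ratio_le_1[of x t \<alpha>] assms \<alpha> by (simp add: kendall_test_def)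
    next
      case False
      then have "1 \<le> (x / t) powr \<alpha>"
        using assms \<alpha> by (intro ge_one_powr_ge_zero) auto
      then show ?thesis
        using False by (simp add: kendall_test_def)
    qed
  qed
  then have "has_bochner_integral \<nu> (\<lambda>x. min 1 ((x / t) powr \<alpha>)) (1 - kendall_G \<alpha> \<nu> t)"
    using int by (subst has_bochner_integral_cong_AE[symmetric]) auto
  then show "kendall_G_bar \<alpha> \<nu> t = (LINT x|\<nu>. min 1 ((x / t) powr \<alpha>))"
    and "integrable \<nu> (\<lambda>x. min 1 ((x / t) powr \<alpha>))"
    by (auto simp: has_bochner_integral_iff kendall_G_bar_def)
qed

text \<open>Dominated convergence: the truncated power tends to 0 for each fixed nonnegative x and
  is bounded by 1.\<close>

lemma kendall_G_bar_tendsto_0: "(kendall_G_bar \<alpha> \<nu> \<longlongrightarrow> 0) at_top"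
proof -
  have "((\<lambda>t. LINT x|\<nu>. min 1 ((x / t) powr \<alpha>)) \<longlongrightarrow> (LINT x|\<nu>. 0)) at_top"
  proof (rule integral_dominated_convergence_at_top)
    show "AE x in \<nu>. ((\<lambda>t. min 1 ((x / t) powr \<alpha>)) \<longlongrightarrow> 0) at_top"
      using \<nu> unfolding nonneg_borel_probs_iff
    proof (elim conjE eventually_mono)
      fix x :: real
      assume x: "0 \<le> x"
      have nonneg: "\<forall>\<^sub>F t in at_top. 0 \<le> x / t"
        using eventually_gt_at_top[of 0] by eventually_elim (use x in simp)
      have "((\<lambda>t. x / t) \<longlongrightarrow> 0) at_top"
        by real_asymp
      then have "((\<lambda>t. (x / t) powr \<alpha>) \<longlongrightarrow> 0) at_top"
        using \<alpha> nonneg by (intro tendsto_zero_powrI[OF _ tendsto_const]) auto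
      then have "((\<lambda>t. min 1 ((x / t) powr \<alpha>)) \<longlongrightarrow> min 1 0) at_top"
        by (intro tendsto_intros)
      then show "((\<lambda>t. min 1 ((x / t) powr \<alpha>)) \<longlongrightarrow> 0) at_top" by simp
    qed
    show "\<forall>\<^sub>F t in at_top. AE x in \<nu>. norm (min 1 ((x / t) powr \<alpha>)) \<le> 1"
      by (auto intro!: always_eventually AE_I2)
  qed auto
  then have "((\<lambda>t. LINT x|\<nu>. min 1 ((x / t) powr \<alpha>)) \<longlongrightarrow> 0) at_top" by simp
  moreover have "\<forall>\<^sub>F t in at_top. (LINT x|\<nu>. min 1 ((x / t) powr \<alpha>)) = kendall_G_bar \<alpha> \<nu> t"
    using eventually_gt_at_top[of 0] by eventually_elim (simp add: kendall_G_bar_eq)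
  ultimately show ?thesis by (rule Lim_transform_eventually)
qed

text \<open>Integrate \<open>nn_integral_powr_truncated\<close> over x and exchange the order of
  integration: at fixed s the integral of (x / t)^\<alpha> over x up to ts is H(ts) /
  t^\<alpha>.\<close>

lemma kendall_G_bar_eq_integral_H:
  assumes "0 < t"
  shows "has_bochner_integral lborel
    (\<lambda>s. \<alpha> * s powr (- \<alpha> - 1) * (kendall_H \<alpha> \<nu> (t * s) / t powr \<alpha>) * indicator {1..} s)
    (kendall_G_bar \<alpha> \<nu> t)"
proof (rule has_bochner_integral_nn_integral)
  let ?k = "\<lambda>x s. \<alpha> * s powr (- \<alpha> - 1) * ((x / t) powr \<alpha> * indicator {0..t * s} x) * indicator {1..} s"
  interpret pair_sigma_finite lborel \<nu>
    by (simp add: pair_sigma_finite_def N.sigma_finite_measure_axioms lborel.sigma_finite_measure_axioms)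
  \<comment> \<open>The set in the indicator moves with s, so joint measurability is obtained by
    writing it as a comparison of coordinates.\<close>
  have [measurable]: "(\<lambda>p. indicator {0..t * fst p} (snd p) :: real) \<in> borel_measurable (lborel \<Otimes>\<^sub>M \<nu>)"
  proof -
    have "(\<lambda>p. indicator {0..t * fst p} (snd p) :: real)
        = (\<lambda>p. if 0 \<le> snd p \<and> snd p \<le> t * fst p then 1 else 0)"
      by (auto split: split_indicator)
    then show ?thesis by simp
  qed
  have meas: "(\<lambda>(s, x). ennreal (?k x s)) \<in> borel_measurable (lborel \<Otimes>\<^sub>M \<nu>)"
    unfolding case_prod_beta by measurable
  have "ennreal (kendall_G_bar \<alpha> \<nu> t) = (\<integral>\<^sup>+x. ennreal (min 1 ((x / t) powr \<alpha>)) \<partial>\<nu>)"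
    using nn_integral_eq_integral[OF kendall_G_bar_eq(2)[OF assms]] kendall_G_bar_eq(1)[OF assms] by simp
  also have "\<dots> = (\<integral>\<^sup>+x. \<integral>\<^sup>+s. ennreal (?k x s) \<partial>lborel \<partial>\<nu>)"
  proof (rule nn_integral_cong_AE)
    show "AE x in \<nu>. ennreal (min 1 ((x / t) powr \<alpha>)) = (\<integral>\<^sup>+s. ennreal (?k x s) \<partial>lborel)"
      using \<nu> nn_integral_powr_truncated[OF \<alpha> assms]
      by (auto simp: nonneg_borel_probs_iff elim!: eventually_mono)
  qed
  also have "\<dots> = (\<integral>\<^sup>+s. \<integral>\<^sup>+x. ennreal (?k x s) \<partial>\<nu> \<partial>lborel)"
    using Fubini'[OF meas] .
  also have "\<dots> = (\<integral>\<^sup>+s. ennreal (\<alpha> * s powr (- \<alpha> - 1) * (kendall_H \<alpha> \<nu> (t * s) / t powr \<alpha>) * indicator {1..} s) \<partial>lborel)"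
  proof (rule nn_integral_cong)
    fix s :: real
    show "(\<integral>\<^sup>+x. ennreal (?k x s) \<partial>\<nu>)
        = ennreal (\<alpha> * s powr (- \<alpha> - 1) * (kendall_H \<alpha> \<nu> (t * s) / t powr \<alpha>) * indicator {1..} s)"
    proof (cases "1 \<le> s")
      case True
      then have ts: "0 < t * s" using assms by simp
      \<comment> \<open>Since (x / t)^\<alpha> = s^\<alpha> (x / (ts))^\<alpha>, the integrand is a
        multiple of the one in \<open>trunc_moment\<close> at level ts.\<close>
      let ?c = "\<alpha> * s powr (- \<alpha> - 1) * s powr \<alpha>"
      have k: "?k x s = ?c * ((x / (t * s)) powr \<alpha> * indicator {0..t * s} x)" for x
        using True assms by (auto simp: powr_divide powr_mult split: split_indicator)
      have "integrable \<nu> (\<lambda>x. ?k x s)"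
        unfolding k using N.integrable_trunc_moment[OF ts, of \<alpha>] \<alpha> by (intro integrable_mult_right) auto
      then have "(\<integral>\<^sup>+x. ennreal (?k x s) \<partial>\<nu>) = ennreal (LINT x|\<nu>. ?k x s)"
        using \<alpha> by (intro nn_integral_eq_integral) auto
      also have "(LINT x|\<nu>. ?k x s) = ?c * trunc_moment \<alpha> (t * s) \<nu>"
        unfolding k trunc_moment_def by simp
      also have "\<dots> = \<alpha> * s powr (- \<alpha> - 1) * (kendall_H \<alpha> \<nu> (t * s) / t powr \<alpha>) * indicator {1..} s"
        using True assms by (simp add: kendall_H_eq[OF ts] powr_mult)
      finally show ?thesis .
    qed simp
  qed
  finally show "(\<integral>\<^sup>+s. ennreal (\<alpha> * s powr (- \<alpha> - 1) * (kendall_H \<alpha> \<nu> (t * s) / t powr \<alpha>) * indicator {1..} s) \<partial>lborel)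
    = ennreal (kendall_G_bar \<alpha> \<nu> t)" by simp
  show "0 \<le> kendall_G_bar \<alpha> \<nu> t"
    unfolding kendall_G_bar_eq(1)[OF assms] by (intro Bochner_Integration.integral_nonneg) auto
  show "AE s in lborel. 0 \<le> \<alpha> * s powr (- \<alpha> - 1) * (kendall_H \<alpha> \<nu> (t * s) / t powr \<alpha>) * indicator {1..} s"
    using \<alpha> kendall_H_nonneg by (intro AE_I2) auto
  have H_eq: "kendall_H \<alpha> \<nu> (t * s) = (LINT x|\<nu>. x powr \<alpha> * indicator {0..t * s} x)" for s
    by (simp add: kendall_H_def set_lebesgue_integral_def mult.commute)
  have "(\<lambda>s. kendall_H \<alpha> \<nu> (t * s)) \<in> borel_measurable lborel"
    unfolding H_eq by (intro N.borel_measurable_lebesgue_integral) (simp add: case_prod_beta)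
  then show "(\<lambda>s. \<alpha> * s powr (- \<alpha> - 1) * (kendall_H \<alpha> \<nu> (t * s) / t powr \<alpha>) * indicator {1..} s) \<in> borel_measurable lborel"
    by measurable
qed

text \<open>Normalising H(ts) by H(t) instead of t^\<alpha> multiplies the integral for 1 - G by
  t^\<alpha> / H(t) = 1 / h(t). Karamata's integral is thus (1 - G) / h, and its limit \<alpha> /
  (\<alpha> - \<theta>) is inverted.\<close>

lemma kendall_ratio_tendsto:
  assumes "0 \<le> \<theta>" "\<theta> < \<alpha>" "regularly_varying \<theta> (kendall_H \<alpha> \<nu>)"
  shows "((\<lambda>t. trunc_moment \<alpha> t \<nu> / kendall_G_bar \<alpha> \<nu> t) \<longlongrightarrow> 1 - \<theta> / \<alpha>) at_top"
proof -
  have "\<forall>\<^sub>F t in at_top. 0 < kendall_H \<alpha> \<nu> t"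
    using assms(3) by (simp add: regularly_varying_def)
  then have ev: "\<forall>\<^sub>F t in at_top. inverse (LINT s|lborel. \<alpha> * s powr (- \<alpha> - 1)
      * (kendall_H \<alpha> \<nu> (t * s) / kendall_H \<alpha> \<nu> t) * indicator {1..} s)
      = trunc_moment \<alpha> t \<nu> / kendall_G_bar \<alpha> \<nu> t"
    using eventually_gt_at_top[of 0]
  proof eventually_elim
    case (elim t)
    let ?I = "\<lambda>c. LINT s|lborel. \<alpha> * s powr (- \<alpha> - 1) * (kendall_H \<alpha> \<nu> (t * s) / c) * indicator {1..} s"
    have "?I (kendall_H \<alpha> \<nu> t) = (LINT s|lborel. t powr \<alpha> / kendall_H \<alpha> \<nu> t *
        (\<alpha> * s powr (- \<alpha> - 1) * (kendall_H \<alpha> \<nu> (t * s) / t powr \<alpha>) * indicator {1..} s))"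
      using elim by (intro Bochner_Integration.integral_cong) auto
    also have "\<dots> = t powr \<alpha> / kendall_H \<alpha> \<nu> t * ?I (t powr \<alpha>)"
      by (rule integral_mult_right_zero)
    also have "?I (t powr \<alpha>) = kendall_G_bar \<alpha> \<nu> t"
      using kendall_G_bar_eq_integral_H[OF elim(2)] by (simp add: has_bochner_integral_iff)
    also have "t powr \<alpha> / kendall_H \<alpha> \<nu> t = 1 / trunc_moment \<alpha> t \<nu>"
      using elim by (simp add: kendall_H_eq)
    finally show ?case by simp
  qed
  have "((\<lambda>t. inverse (LINT s|lborel. \<alpha> * s powr (- \<alpha> - 1)
      * (kendall_H \<alpha> \<nu> (t * s) / kendall_H \<alpha> \<nu> t) * indicator {1..} s)) \<longlongrightarrow> inverse (\<alpha> / (\<alpha> - \<theta>))) at_top"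
    using assms \<alpha> by (intro tendsto_inverse Karamata_tail_integral kendall_H_mono kendall_H_nonneg) auto
  moreover have "inverse (\<alpha> / (\<alpha> - \<theta>)) = 1 - \<theta> / \<alpha>"
    using \<alpha> by (simp add: field_simps)
  ultimately show ?thesis
    using Lim_transform_eventually[OF _ ev] by simp
qed

text \<open>1 - G is the mass missing from \<open>{0..t}\<close> plus h, hence at least h.\<close>

lemma kendall_G_bar_pos:
  assumes "0 < t" "0 < kendall_H \<alpha> \<nu> t"
  shows "0 < kendall_G_bar \<alpha> \<nu> t"
proof -
  have "0 < trunc_moment \<alpha> t \<nu>"
    using assms by (simp add: kendall_H_eq zero_less_mult_iff)
  then show ?thesis
    using N.prob_le_1[of "{0..t}"] unfolding kendall_G_bar_def kendall_G_eq[OF assms(1)] by linarith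
qed

end

section \<open>The limit law\<close>

lemma gamma_measure_eq_erlang:
  "gamma_measure (real (Suc k)) 1 = density lborel (erlang_density k 1)"
  unfolding gamma_measure_def
proof (rule density_cong)
  show "AE x in lborel. ennreal (1 powr real (Suc k) / Gamma (real (Suc k)) * x powr (real (Suc k) - 1)
      * exp (- 1 * x) * indicator {0..} x) = ennreal (erlang_density k 1 x)"
    \<comment> \<open>The point 0 is removed: for k = 0 the densities differ there, since
      \<open>0 powr 0\<close> is 0 while \<open>0 ^ 0\<close> is 1.\<close>
    using AE_lborel_singleton[of 0]
  proof eventually_elim
    case (elim x)
    have "Gamma (real (Suc k)) = fact k"
      using Gamma_fact[of k, where 'a = real] by (simp add: add.commute)
    then show ?case
      using elim by (auto simp: erlang_density_def powr_realpow field_simps split: split_indicator)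
  qed
qed (auto intro!: borel_measurable_erlang_density)

text \<open>Both components are Erlang laws, with distribution functions 1 - exp(-x) and 1 - (1 + x)
  exp(-x) on the half-line. Their mixture collapses to the form in which the limit of
  \<open>renewal_cdf\<close> appears.\<close>

lemma gamma_mixture:
  fixes p :: real
  assumes "0 \<le> p" "p \<le> 1"
  shows "real_distribution (convex_comb p (gamma_measure 1 1) (gamma_measure 2 1))"
    and "cdf (convex_comb p (gamma_measure 1 1) (gamma_measure 2 1)) x
      = (if x < 0 then 0 else 1 - (1 + (1 - p) * x) * exp (- x))"
proof -
  have eqs: "gamma_measure 1 1 = density lborel (erlang_density 0 1)"
    "gamma_measure 2 1 = density lborel (erlang_density 1 1)"
    using gamma_measure_eq_erlang[of 0] gamma_measure_eq_erlang[of 1] by simp_all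
  let ?L = "convex_comb p (density lborel (erlang_density 0 1)) (density lborel (erlang_density 1 1))"
  have "prob_space ?L"
    using assms by (intro prob_space_convex_comb prob_space_erlang_density) auto
  then show "real_distribution (convex_comb p (gamma_measure 1 1) (gamma_measure 2 1))"
    by (simp add: eqs real_distribution_def real_distribution_axioms_def)
  have "emeasure ?L {..x} = ennreal (p * erlang_CDF 0 1 x + (1 - p) * erlang_CDF 1 1 x)"
    using assms by (simp add: emeasure_convex_comb emeasure_erlang_density ennreal_mult)
  then have "cdf ?L x = p * erlang_CDF 0 1 x + (1 - p) * erlang_CDF 1 1 x"
    using assms by (simp add: cdf_def measure_def del: ennreal_plus)
  also have "\<dots> = (if x < 0 then 0 else 1 - (1 + (1 - p) * x) * exp (- x))"
    by (simp add: erlang_CDF_def algebra_simps)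
  finally show "cdf (convex_comb p (gamma_measure 1 1) (gamma_measure 2 1)) x
      = (if x < 0 then 0 else 1 - (1 + (1 - p) * x) * exp (- x))"
    by (simp only: eqs)
qed

lemma convex_comb_0:
  assumes "sets N = sets M"
  shows "convex_comb 0 M N = N"
  using assms by (intro measure_eqI) (auto simp: emeasure_convex_comb)

section \<open>Limits along the rounded index\<close>

text \<open>The power is the exponential of \<epsilon> k times ln (1 - \<epsilon>) / \<epsilon>, and
  this quotient tends to -1.\<close>

lemma tendsto_one_minus_power:
  fixes \<epsilon> :: "'b \<Rightarrow> real" and k :: "'b \<Rightarrow> nat"
  assumes "(\<epsilon> \<longlongrightarrow> 0) F" "\<forall>\<^sub>F t in F. 0 < \<epsilon> t" "((\<lambda>t. \<epsilon> t * real (k t)) \<longlongrightarrow> x) F"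
  shows "((\<lambda>t. (1 - \<epsilon> t) ^ k t) \<longlongrightarrow> exp (- x)) F"
proof -
  have "filterlim \<epsilon> (at_right 0) F"
    using assms(1,2) by (auto simp: filterlim_at elim!: eventually_mono)
  moreover have "((\<lambda>y :: real. ln (1 - y) / y) \<longlongrightarrow> - 1) (at_right 0)"
    by real_asymp
  ultimately have "((\<lambda>t. ln (1 - \<epsilon> t) / \<epsilon> t) \<longlongrightarrow> - 1) F"
    by (rule filterlim_compose[rotated])
  then have "((\<lambda>t. exp (\<epsilon> t * real (k t) * (ln (1 - \<epsilon> t) / \<epsilon> t))) \<longlongrightarrow> exp (x * - 1)) F"
    by (intro tendsto_intros assms)
  moreover have "\<forall>\<^sub>F t in F. exp (\<epsilon> t * real (k t) * (ln (1 - \<epsilon> t) / \<epsilon> t)) = (1 - \<epsilon> t) ^ k t"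
    \<comment> \<open>Eventually \<epsilon> is below 1, so that \<open>exp\<close> inverts the
      logarithm of 1 - \<epsilon>.\<close>
    using assms(2) order_tendstoD(2)[OF assms(1), of 1, simplified]
    by eventually_elim (simp add: exp_of_nat_mult)
  ultimately show ?thesis
    using Lim_transform_eventually by fastforce
qed

text \<open>Rounding down loses at most 1, so the product lies between x - \<epsilon> and x.\<close>

lemma tendsto_mult_floor_divide:
  fixes \<epsilon> :: "'b \<Rightarrow> real"
  assumes "(\<epsilon> \<longlongrightarrow> 0) F" "\<forall>\<^sub>F t in F. 0 < \<epsilon> t" "0 \<le> x"
  shows "((\<lambda>t. \<epsilon> t * real (nat \<lfloor>x / \<epsilon> t\<rfloor>)) \<longlongrightarrow> x) F"
proof (rule tendsto_sandwich)
  show "((\<lambda>t. x - \<epsilon> t) \<longlongrightarrow> x) F"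
    using tendsto_diff[OF tendsto_const assms(1), of x] by simp
  show "\<forall>\<^sub>F t in F. x - \<epsilon> t \<le> \<epsilon> t * real (nat \<lfloor>x / \<epsilon> t\<rfloor>)"
    using assms(2)
  proof eventually_elim
    case (elim t)
    have "x / \<epsilon> t - 1 \<le> real (nat \<lfloor>x / \<epsilon> t\<rfloor>)"
      by linarith
    then have "\<epsilon> t * (x / \<epsilon> t - 1) \<le> \<epsilon> t * real (nat \<lfloor>x / \<epsilon> t\<rfloor>)"
      using elim by (intro mult_left_mono) auto
    then show ?case using elim by (simp add: right_diff_distrib)
  qed
  show "\<forall>\<^sub>F t in F. \<epsilon> t * real (nat \<lfloor>x / \<epsilon> t\<rfloor>) \<le> x"
    using assms(2)
  proof eventually_elim
    case (elim t)
    have "real (nat \<lfloor>x / \<epsilon> t\<rfloor>) \<le> x / \<epsilon> t"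
      using elim assms(3) by simp
    then show ?case using elim by (simp add: field_simps)
  qed
qed simp

text \<open>Brings the scaled event into the form covered by \<open>renewal_cdf\<close>. A finite N
  is an integer, so its bound may be rounded down; an infinite N fails on both sides because c >
  0.\<close>

lemma ereal_mult_enat_le_iff:
  assumes "0 < c" "0 \<le> x"
  shows "ereal c * ereal_of_enat N \<le> ereal x \<longleftrightarrow> N \<le> enat (nat \<lfloor>x / c\<rfloor>)"
proof (cases N)
  case (enat n)
  have "c * real n \<le> x \<longleftrightarrow> real n \<le> x / c"
    using assms by (simp add: field_simps)
  also have "\<dots> \<longleftrightarrow> n \<le> nat \<lfloor>x / c\<rfloor>"
    using assms by (simp add: le_nat_iff le_floor_iff)
  finally show ?thesis using enat by simp
qed (use assms in auto)

lemma kendall_renewal_limit: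
  fixes M :: "'a measure"
  assumes \<alpha>: "\<alpha> > 0" and \<nu>: "\<nu> \<in> nonneg_borel_probs" and walk: "kendall_random_walk M \<alpha> \<nu> S"
    and \<theta>: "0 \<le> \<theta>" "\<theta> < \<alpha>" and rv: "regularly_varying \<theta> (kendall_H \<alpha> \<nu>)"
  shows "converges_in_distribution M
    (\<lambda>t \<omega>. ereal (kendall_G_bar \<alpha> \<nu> t) * ereal_of_enat (renewal_process S t \<omega>))
    (convex_comb (\<theta> / \<alpha>) (gamma_measure 1 1) (gamma_measure 2 1)) at_top"
  unfolding converges_in_distribution_def
proof (intro conjI allI impI)
  let ?L = "convex_comb (\<theta> / \<alpha>) (gamma_measure 1 1) (gamma_measure 2 1)"
  have p: "0 \<le> \<theta> / \<alpha>" "\<theta> / \<alpha> \<le> 1" using \<alpha> \<theta> by auto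
  show "real_distribution ?L" by (rule gamma_mixture[OF p])
  fix x :: real
  define \<epsilon> where "\<epsilon> = kendall_G_bar \<alpha> \<nu>"
  define h where "h = (\<lambda>t. trunc_moment \<alpha> t \<nu>)"
  define k where "k = (\<lambda>t. nat \<lfloor>x / \<epsilon> t\<rfloor>)"
  let ?P = "\<lambda>t. measure M {\<omega> \<in> space M. ereal (kendall_G_bar \<alpha> \<nu> t)
      * ereal_of_enat (renewal_process S t \<omega>) \<le> ereal x}"
  have \<epsilon>0: "(\<epsilon> \<longlongrightarrow> 0) at_top"
    unfolding \<epsilon>_def by (rule kendall_G_bar_tendsto_0[OF \<alpha> \<nu>])
  have "\<forall>\<^sub>F t in at_top. 0 < kendall_H \<alpha> \<nu> t"
    using rv by (simp add: regularly_varying_def)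
  then have \<epsilon>_pos: "\<forall>\<^sub>F t in at_top. 0 < \<epsilon> t"
    using eventually_gt_at_top[of 0]
    by eventually_elim (simp add: \<epsilon>_def kendall_G_bar_pos[OF \<alpha> \<nu>])
  have ratio: "((\<lambda>t. h t / \<epsilon> t) \<longlongrightarrow> 1 - \<theta> / \<alpha>) at_top"
    unfolding h_def \<epsilon>_def by (rule kendall_ratio_tendsto[OF \<alpha> \<nu> \<theta> rv])
  show "(?P \<longlongrightarrow> cdf ?L x) at_top"
  proof (cases "x < 0")
    \<comment> \<open>The scaled renewal process is nonnegative once \<epsilon> is positive, so
      below 0 its distribution function vanishes, as does that of the limit.\<close>
    case True
    have "\<forall>\<^sub>F t in at_top. 0 = ?P t"
      using \<epsilon>_pos
    proof eventually_elim
      case (elim t)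
      have "0 \<le> ereal (\<epsilon> t) * ereal_of_enat N" for N
        using elim by (intro ereal_0_le_mult) auto
      then have "\<not> ereal (\<epsilon> t) * ereal_of_enat N \<le> ereal x" for N
        using True order_trans[of 0 "ereal (\<epsilon> t) * ereal_of_enat N" "ereal x"] by auto
      then show ?case by (simp add: \<epsilon>_def)
    qed
    then have "(?P \<longlongrightarrow> 0) at_top"
      by (rule Lim_transform_eventually[OF tendsto_const])
    then show ?thesis
      using True by (simp add: gamma_mixture(2)[OF p])
  next
    case False
    then have x: "0 \<le> x" by simp
    have \<epsilon>k: "((\<lambda>t. \<epsilon> t * real (k t)) \<longlongrightarrow> x) at_top"
      unfolding k_def by (rule tendsto_mult_floor_divide[OF \<epsilon>0 \<epsilon>_pos x])
    \<comment> \<open>The factor (k + 1) h from \<open>renewal_cdf\<close> is written as (\<epsilon>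
      k + \<epsilon>) (h / \<epsilon>), so that every factor has a limit of its own.\<close>
    have "((\<lambda>t. 1 - ((1 - \<epsilon> t) ^ k t * (1 - \<epsilon> t) + (\<epsilon> t * real (k t) + \<epsilon> t) * (h t / \<epsilon> t) * (1 - \<epsilon> t) ^ k t))
        \<longlongrightarrow> 1 - (exp (- x) * (1 - 0) + (x + 0) * (1 - \<theta> / \<alpha>) * exp (- x))) at_top"
      by (intro tendsto_intros tendsto_one_minus_power \<epsilon>0 \<epsilon>_pos \<epsilon>k ratio)
    also have "1 - (exp (- x) * (1 - 0) + (x + 0) * (1 - \<theta> / \<alpha>) * exp (- x)) = cdf ?L x"
      using x by (simp add: gamma_mixture(2)[OF p] algebra_simps)
    finally have lim: "((\<lambda>t. 1 - ((1 - \<epsilon> t) ^ k t * (1 - \<epsilon> t)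
        + (\<epsilon> t * real (k t) + \<epsilon> t) * (h t / \<epsilon> t) * (1 - \<epsilon> t) ^ k t)) \<longlongrightarrow> cdf ?L x) at_top" .
    have "\<forall>\<^sub>F t in at_top. 1 - ((1 - \<epsilon> t) ^ k t * (1 - \<epsilon> t)
        + (\<epsilon> t * real (k t) + \<epsilon> t) * (h t / \<epsilon> t) * (1 - \<epsilon> t) ^ k t) = ?P t"
      using \<epsilon>_pos eventually_gt_at_top[of 0]
    proof eventually_elim
      case (elim t)
      have g: "measure \<nu> {0..t} - trunc_moment \<alpha> t \<nu> = 1 - \<epsilon> t"
        by (simp add: \<epsilon>_def kendall_G_bar_def kendall_G_eq[OF \<alpha> \<nu> elim(2)])
      have "?P t = measure M {\<omega>\<in>space M. renewal_process S t \<omega> \<le> enat (k t)}"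
        unfolding k_def using ereal_mult_enat_le_iff[OF elim(1) x] by (simp add: \<epsilon>_def)
      also have "\<dots> = 1 - ((1 - \<epsilon> t) ^ Suc (k t) + real (Suc (k t)) * h t * (1 - \<epsilon> t) ^ k t)"
        using renewal_cdf[OF \<alpha> \<nu> walk elim(2)] by (simp add: g h_def)
      also have "real (Suc (k t)) * h t = (\<epsilon> t * real (k t) + \<epsilon> t) * (h t / \<epsilon> t)"
        using elim by (simp add: field_simps)
      finally show ?case
        by (simp add: mult.commute)
    qed
    then show ?thesis
      using lim by (rule Lim_transform_eventually[rotated])
  qed
qed

theorem theorem6:
  fixes \<alpha> :: real and \<nu> :: "real measure"
    and M :: "'a measure" and S :: "nat \<Rightarrow> 'a \<Rightarrow> real"
  assumes "\<alpha> > 0"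
    and "\<nu> \<in> nonneg_borel_probs"
    and "kendall_random_walk M \<alpha> \<nu> S"
  shows
    "(\<forall>\<theta>. 0 \<le> \<theta> \<and> \<theta> < \<alpha> \<and> regularly_varying \<theta> (kendall_H \<alpha> \<nu>) \<longrightarrow>
        converges_in_distribution M
          (\<lambda>t \<omega>. ereal (kendall_G_bar \<alpha> \<nu> t) * ereal_of_enat (renewal_process S t \<omega>))
          (convex_comb (\<theta> / \<alpha>) (gamma_measure 1 1) (gamma_measure 2 1)) at_top)
   \<and> (regularly_varying 0 (kendall_H \<alpha> \<nu>) \<longrightarrow>
        converges_in_distribution M
          (\<lambda>t \<omega>. ereal (kendall_G_bar \<alpha> \<nu> t) * ereal_of_enat (renewal_process S t \<omega>))
          (gamma_measure 2 1) at_top)"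
proof (intro conjI allI impI)
  show "converges_in_distribution M
      (\<lambda>t \<omega>. ereal (kendall_G_bar \<alpha> \<nu> t) * ereal_of_enat (renewal_process S t \<omega>))
      (convex_comb (\<theta> / \<alpha>) (gamma_measure 1 1) (gamma_measure 2 1)) at_top"
    if "0 \<le> \<theta> \<and> \<theta> < \<alpha> \<and> regularly_varying \<theta> (kendall_H \<alpha> \<nu>)" for \<theta>
    using that by (intro kendall_renewal_limit[OF assms]) auto
  assume "regularly_varying 0 (kendall_H \<alpha> \<nu>)"
  then have "converges_in_distribution M
      (\<lambda>t \<omega>. ereal (kendall_G_bar \<alpha> \<nu> t) * ereal_of_enat (renewal_process S t \<omega>))
      (convex_comb (0 / \<alpha>) (gamma_measure 1 1) (gamma_measure 2 1)) at_top"
    by (intro kendall_renewal_limit[OF assms] order_refl assms(1))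
  \<comment> \<open>At \<theta> = 0 the exponential component has weight 0, so part (ii) is a case
    of part (i).\<close>
  moreover have "convex_comb (0 / \<alpha>) (gamma_measure 1 1) (gamma_measure 2 1) = gamma_measure 2 1"
    unfolding div_0 by (rule convex_comb_0) (simp add: gamma_measure_def)
  ultimately show "converges_in_distribution M
      (\<lambda>t \<omega>. ereal (kendall_G_bar \<alpha> \<nu> t) * ereal_of_enat (renewal_process S t \<omega>))
      (gamma_measure 2 1) at_top"
    by simp
qed

end
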